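(* Let $\Omega\subset\mathbb{R}^2$ be any bounded simply connected domain with real analytic boundary. Let $u=\nabla^\perp\psi$, $B=\nabla^\perp A$, with pressure $p$, be an analytic fixed boundary steady MHD solution on $\Omega$, i.e. $$u\cdot\nabla u-B\cdot\nabla B=-\nabla p,\qquad u\cdot\nabla B-B\cdot\nabla u=0,\qquad \nabla\cdot B=\nabla\cdot u=0\qquad\text{in }\Omega,$$ $$B\cdot\hat n=0,\qquad u\cdot\hat n=0\qquad\text{on }\partial\Omega,$$ with $B$ non-vanishing except at a single point, and let $G,H:\mathbb{R}\to\mathbb{R}$ (of class $C^k$ and $C^{k-1}$ respectively, for some $k\ge 2$) be the functions such that $$\psi=G(A),\qquad p+\tfrac12|u|^2-\tfrac12|B|^2=H(A)\qquad\text{in }\Omega .$$ Suppose that $$|B|^2>-\frac{2H(0)}{1-|G'(0)|^2}\qquad\text{on }\partial\Omega .$$ Then there exists an external magnetic field $B_{\mathsf{ext}}$ generated by a current sheet which makes $(u,B,\Omega)$ into a free boundary equilibrium; that is, there exist a smooth Jordan curve $\Gamma$ surrounding $\Omega$, a scalar function $j:\Gamma\to\mathbb{R}$ and a field $B_{\mathsf{ext}}$ on $\mathbb{R}^2\setminus\Omega$ generated by the current sheet $(\Gamma,j)$ such that $$B_{\mathsf{ext}}\cdot\hat n=0\quad\text{and}\quad p=\tfrac12|B_{\mathsf{ext}}|^2\qquad\text{on }\partial\Omega .$$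
   Context: $\nabla^\perp=(-\partial_2,\partial_1)$ and $\hat n$ is the unit outward normal to $\partial\Omega$. Since $u,B$ are tangent to $\partial\Omega$, the functions $\psi$ and $A$ are constant on $\partial\Omega$; $A$ is normalized by $A=0$ on $\partial\Omega$. A field $B_{\mathsf{ext}}$ on $\mathbb{R}^2\setminus\Omega$ is generated by the current sheet $(\Gamma,j)$, where $\Gamma\subset\mathbb{R}^2\setminus\overline\Omega$ is a Jordan curve enclosing $\Omega$, if $B_{\mathsf{ext}}=\nabla^\perp A_{\mathsf{ext}}$ with $\Delta A_{\mathsf{ext}}=j\,\delta_\Gamma$ in the sense of distributions in $\mathbb{R}^2\setminus\overline\Omega$ (so $\nabla\cdot B_{\mathsf{ext}}=0$ and $\nabla^\perp\cdot B_{\mathsf{ext}}=j\delta_\Gamma$) and $\nabla A_{\mathsf{ext}}\to0$ as $|x|\to\infty$. Here $\delta_\Gamma$ is the arc length measure on $\Gamma$.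
   Formalization: The formal theorem adds the hypothesis |G'(0)|<1: for |G'(0)|=1 the displayed quotient is undefined, and for |G'(0)|>1 the displayed inequality forces p<0 on the boundary, so that p=|B_ext|^2/2 is impossible. *)

theory Defs
  imports "HOL-Analysis.Analysis"
begin

section \<open>Regularity classes\<close>

text \<open>Continuous differentiability of order \<open>k\<close>; meant for open \<open>S\<close>.\<close>

primrec Ck_on ::
  "nat \<Rightarrow> ('a::euclidean_space \<Rightarrow> 'b::real_normed_vector) \<Rightarrow> 'a set \<Rightarrow> bool" where
  "Ck_on 0 f S \<longleftrightarrow> continuous_on S f"
| "Ck_on (Suc k) f S \<longleftrightarrow> (\<forall>x\<in>S. f differentiable (at x)) \<and>
     (\<forall>b\<in>Basis. Ck_on k (\<lambda>x. frechet_derivative f (at x) b) S)"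

text \<open>Around every point of \<open>S\<close>, on a full ball of the ambient space, \<open>f\<close> is the sum of a power
  series in the coordinates; the summation index \<open>\<alpha>\<close> is a multi-index over \<open>Basis\<close>. For a set \<open>S\<close>
  that is not open this means that \<open>f\<close> is analytic in a neighbourhood of \<open>S\<close>.\<close>

definition real_analytic_on ::
  "('a::euclidean_space \<Rightarrow> 'b::real_normed_vector) \<Rightarrow> 'a set \<Rightarrow> bool" where
  "real_analytic_on f S \<longleftrightarrow> (\<forall>x\<in>S. \<exists>r>0. \<exists>c. \<forall>y\<in>ball x r.
     ((\<lambda>\<alpha>. (\<Prod>b\<in>Basis. ((y - x) \<bullet> b) ^ \<alpha> b) *\<^sub>R c \<alpha>) has_sum f y) (Basis \<rightarrow>\<^sub>E (UNIV :: nat set)))"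


section \<open>Planar vector calculus\<close>

definition partial :: "2 \<Rightarrow> (real^2 \<Rightarrow> 'b::real_normed_vector) \<Rightarrow> real^2 \<Rightarrow> 'b" where
  "partial i f x = frechet_derivative f (at x) (axis i 1)"

definition grad :: "(real^2 \<Rightarrow> real) \<Rightarrow> real^2 \<Rightarrow> real^2" where
  "grad f x = vector [partial 1 f x, partial 2 f x]"

definition perp_grad :: "(real^2 \<Rightarrow> real) \<Rightarrow> real^2 \<Rightarrow> real^2" where
  "perp_grad f x = vector [- partial 2 f x, partial 1 f x]"

definition divergence :: "(real^2 \<Rightarrow> real^2) \<Rightarrow> real^2 \<Rightarrow> real" where
  "divergence v x = partial 1 v x $ 1 + partial 2 v x $ 2"

definition laplacian :: "(real^2 \<Rightarrow> real) \<Rightarrow> real^2 \<Rightarrow> real" where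
  "laplacian f x = partial 1 (partial 1 f) x + partial 2 (partial 2 f) x"

text \<open>The derivative \<open>v \<cdot> \<nabla>w\<close> of \<open>w\<close> along \<open>v\<close>.\<close>

definition advect :: "(real^2 \<Rightarrow> real^2) \<Rightarrow> (real^2 \<Rightarrow> real^2) \<Rightarrow> real^2 \<Rightarrow> real^2" where
  "advect v w x = v x $ 1 *\<^sub>R partial 1 w x + v x $ 2 *\<^sub>R partial 2 w x"


section \<open>Jordan curves, domains and normals\<close>

text \<open>A closed curve is given by a 1-periodic regular parametrization of the real line; periodicity
  makes the regularity of the parametrization include the closing point.\<close>

definition regular_Jordan_param :: "(real \<Rightarrow> real^2) \<Rightarrow> bool" where
  "regular_Jordan_param \<gamma> \<longleftrightarrow> simple_path \<gamma> \<and> (\<forall>t. \<gamma> (t + 1) = \<gamma> t) \<and>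
     (\<forall>t. \<gamma> differentiable (at t) \<and> vector_derivative \<gamma> (at t) \<noteq> 0)"

definition smooth_Jordan_param :: "(real \<Rightarrow> real^2) \<Rightarrow> bool" where
  "smooth_Jordan_param \<gamma> \<longleftrightarrow> regular_Jordan_param \<gamma> \<and> (\<forall>k. Ck_on k \<gamma> UNIV)"

definition analytic_Jordan_param :: "(real \<Rightarrow> real^2) \<Rightarrow> bool" where
  "analytic_Jordan_param \<gamma> \<longleftrightarrow> regular_Jordan_param \<gamma> \<and> real_analytic_on \<gamma> UNIV"

text \<open>The boundary of a bounded simply connected planar domain is a single closed curve, so an
  analytic boundary is a regular analytic Jordan curve.\<close>

definition bounded_sc_analytic_domain :: "(real^2) set \<Rightarrow> bool" where
  "bounded_sc_analytic_domain \<Omega> \<longleftrightarrow> open \<Omega> \<and> \<Omega> \<noteq> {} \<and> connected \<Omega> \<and> bounded \<Omega> \<and>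
     simply_connected \<Omega> \<and> (\<exists>\<gamma>. analytic_Jordan_param \<gamma> \<and> path_image \<gamma> = frontier \<Omega>)"

text \<open>Near \<open>x\<close> the set \<open>\<Omega>\<close> is, to first order, the half plane \<open>(y - x) \<bullet> n < 0\<close>. At a boundary point
  of a domain with differentiable boundary exactly one \<open>n\<close> has this property.\<close>

definition outward_unit_normal :: "(real^2) set \<Rightarrow> real^2 \<Rightarrow> real^2 \<Rightarrow> bool" where
  "outward_unit_normal \<Omega> x n \<longleftrightarrow> norm n = 1 \<and>
     (\<forall>\<epsilon>>0. \<forall>\<^sub>F y in at x.
        ((y - x) \<bullet> n < - \<epsilon> * norm (y - x) \<longrightarrow> y \<in> \<Omega>) \<and>
        ((y - x) \<bullet> n > \<epsilon> * norm (y - x) \<longrightarrow> y \<notin> closure \<Omega>))"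


section \<open>Steady MHD with fixed boundary\<close>

definition analytic_MHD_solution ::
  "(real^2) set \<Rightarrow> (real^2 \<Rightarrow> real^2) \<Rightarrow> (real^2 \<Rightarrow> real^2) \<Rightarrow> (real^2 \<Rightarrow> real) \<Rightarrow> bool" where
  "analytic_MHD_solution \<Omega> u B p \<longleftrightarrow>
     real_analytic_on u (closure \<Omega>) \<and> real_analytic_on B (closure \<Omega>) \<and>
     real_analytic_on p (closure \<Omega>) \<and>
     (\<forall>x\<in>\<Omega>. advect u u x - advect B B x = - grad p x) \<and>
     (\<forall>x\<in>\<Omega>. advect u B x - advect B u x = 0) \<and>
     (\<forall>x\<in>\<Omega>. divergence B x = 0 \<and> divergence u x = 0) \<and>
     (\<forall>x\<in>frontier \<Omega>. \<forall>n. outward_unit_normal \<Omega> x n \<longrightarrow> B x \<bullet> n = 0 \<and> u x \<bullet> n = 0)"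

text \<open>\<open>f\<close> is a stream function of \<open>v\<close> in \<open>\<Omega>\<close>, continuous up to the boundary.\<close>

definition stream_function :: "(real^2) set \<Rightarrow> (real^2 \<Rightarrow> real) \<Rightarrow> (real^2 \<Rightarrow> real^2) \<Rightarrow> bool" where
  "stream_function \<Omega> f v \<longleftrightarrow> continuous_on (closure \<Omega>) f \<and>
     (\<forall>x\<in>\<Omega>. f differentiable (at x) \<and> v x = perp_grad f x)"


section \<open>External fields generated by current sheets\<close>

definition test_function :: "(real^2) set \<Rightarrow> (real^2 \<Rightarrow> real) \<Rightarrow> bool" where
  "test_function V \<phi> \<longleftrightarrow> (\<forall>k. Ck_on k \<phi> UNIV) \<and>
     compact (closure {x. \<phi> x \<noteq> 0}) \<and> closure {x. \<phi> x \<noteq> 0} \<subseteq> V"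

definition locally_integrable_on ::
  "(real^2 \<Rightarrow> 'b::euclidean_space) \<Rightarrow> (real^2) set \<Rightarrow> bool" where
  "locally_integrable_on f V \<longleftrightarrow> (\<forall>K. compact K \<longrightarrow> K \<subseteq> V \<longrightarrow> f absolutely_integrable_on K)"

definition arclength_measure :: "(real \<Rightarrow> real^2) \<Rightarrow> (real^2) measure" where
  "arclength_measure \<gamma> =
     distr (density (restrict_space lborel {0..1}) (\<lambda>t. ennreal (norm (vector_derivative \<gamma> (at t)))))
       borel \<gamma>"

text \<open>The conditions \<open>B = \<nabla>\<^sup>\<bottom>a\<close> and \<open>\<Delta>a = j \<delta>\<^sub>\<Gamma>\<close>, for the curve \<open>\<Gamma>\<close> parametrized by \<open>\<gamma>\<close>, are
  tested against functions supported outside the closure of \<open>\<Omega>\<close>. Since the first one only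
  determines \<open>B\<close> almost everywhere outside the closure, \<open>B\<close> is required to be continuous off \<open>\<Gamma>\<close> and
  up to the boundary of \<open>\<Omega>\<close>; its boundary values are thus those of the exterior field. As \<open>\<nabla>a\<close> and
  \<open>\<nabla>\<^sup>\<bottom>a\<close> have the same norm, the decay of \<open>\<nabla>a\<close> is that of \<open>B\<close>.\<close>

definition generated_by_current_sheet ::
  "(real^2) set \<Rightarrow> (real \<Rightarrow> real^2) \<Rightarrow> (real^2 \<Rightarrow> real) \<Rightarrow> (real^2 \<Rightarrow> real^2) \<Rightarrow> bool" where
  "generated_by_current_sheet \<Omega> \<gamma> j B \<longleftrightarrow>
     path_image \<gamma> \<subseteq> - closure \<Omega> \<and> \<Omega> \<subseteq> inside (path_image \<gamma>) \<and>
     integrable (arclength_measure \<gamma>) j \<and>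
     continuous_on (- \<Omega> - path_image \<gamma>) B \<and>
     locally_integrable_on B (- closure \<Omega>) \<and>
     (\<exists>a. locally_integrable_on a (- closure \<Omega>) \<and>
        (\<forall>\<phi>. test_function (- closure \<Omega>) \<phi> \<longrightarrow>
           (LINT x|lebesgue. \<phi> x *\<^sub>R B x) = - (LINT x|lebesgue. a x *\<^sub>R perp_grad \<phi> x)) \<and>
        (\<forall>\<phi>. test_function (- closure \<Omega>) \<phi> \<longrightarrow>
           (LINT x|lebesgue. a x * laplacian \<phi> x) = (LINT x|arclength_measure \<gamma>. j x * \<phi> x))) \<and>
     (B \<longlongrightarrow> 0) at_infinity"

end

theory Submission
  imports Defs "HOL-Complex_Analysis.Complex_Analysis"
begin

text \<open>On the boundary \<open>u = G'(0) B\<close>, so Bernoulli's law and the lower bound on \<open>|B|\<close> make \<open>p\<close> positive there.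
  Reparametrize the boundary by the flux of a tangential field of strength \<open>\<surd>(2p)\<close>: up to a factor \<open>c\<close>
  this gives a 1-periodic analytic parametrization of speed \<open>c / \<surd>(2p)\<close>, which extends to a holomorphic
  map \<open>F\<close> of a thin strip, injective modulo 1. In the coordinate \<open>F\<^sup>-\<^sup>1\<close> the solution of the Cauchy problem
  \<open>\<Delta>a = 0\<close>, \<open>a\<close> constant and \<open>|\<nabla>a| = \<surd>(2p)\<close> on the boundary, is \<open>c Im\<close>. The current sheet is the level
  curve \<open>Im = \<epsilon>\<close>, beyond which the potential is continued by a constant. Being conformal, \<open>F\<close> turns the weak
  equations into integrations by parts over a period of the strip.\<close>

no_notation fps_nth (infixl "$" 75)

section \<open>Local holomorphic extensions of functions of a real variable\<close>

definition hol_ext_at :: "(real \<Rightarrow> complex) \<Rightarrow> real \<Rightarrow> bool" where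
  "hol_ext_at f t \<longleftrightarrow>
     (\<exists>g. g analytic_on {of_real t} \<and> (\<forall>\<^sub>F x in nhds t. f x = g (of_real x)))"

lemma hol_ext_atI:
  assumes "g analytic_on {of_real t}" "\<forall>\<^sub>F x in nhds t. f x = g (of_real x)"
  shows "hol_ext_at f t"
  using assms unfolding hol_ext_at_def by blast

lemma hol_ext_atE:
  assumes "hol_ext_at f t"
  obtains g r where "r > 0" "g holomorphic_on ball (of_real t) r"
    "\<And>x. \<bar>x - t\<bar> < r \<Longrightarrow> f x = g (of_real x)"
proof -
  from assms obtain g where g: "g analytic_on {of_real t}"
    and ev: "\<forall>\<^sub>F x in nhds t. f x = g (of_real x)"
    unfolding hol_ext_at_def by blast
  from g obtain r1 where r1: "r1 > 0" "g holomorphic_on ball (of_real t) r1"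
    unfolding analytic_on_def by auto
  from ev obtain r2 where r2: "r2 > 0" "\<And>x. dist x t < r2 \<Longrightarrow> f x = g (of_real x)"
    unfolding eventually_nhds_metric by blast
  show thesis
  proof (rule that[of "min r1 r2" g])
    show "g holomorphic_on ball (of_real t) (min r1 r2)"
      using r1(2) by (rule holomorphic_on_subset) auto
  qed (use r1 r2 in \<open>auto simp: dist_real_def\<close>)
qed

lemma hol_ext_at_cong:
  assumes "hol_ext_at f t" "\<forall>\<^sub>F x in nhds t. h x = f x"
  shows "hol_ext_at h t"
  using assms unfolding hol_ext_at_def
  by (smt (verit, ccfv_SIG) eventually_elim2)

lemma hol_ext_at_of_real: "hol_ext_at of_real t"
  by (rule hol_ext_atI[of "\<lambda>z. z"]) auto

lemma hol_ext_at_const: "hol_ext_at (\<lambda>_. c) t"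
  by (rule hol_ext_atI[of "\<lambda>z. c"]) auto

lemma hol_ext_at_add:
  assumes "hol_ext_at f t" "hol_ext_at g t"
  shows "hol_ext_at (\<lambda>x. f x + g x) t"
proof -
  obtain F G where "F analytic_on {of_real t}" "\<forall>\<^sub>F x in nhds t. f x = F (of_real x)"
    and "G analytic_on {of_real t}" "\<forall>\<^sub>F x in nhds t. g x = G (of_real x)"
    using assms unfolding hol_ext_at_def by blast
  then show ?thesis
    by (intro hol_ext_atI[of "\<lambda>z. F z + G z"])
       (auto intro: analytic_on_add elim: eventually_elim2)
qed

lemma hol_ext_at_mult:
  assumes "hol_ext_at f t" "hol_ext_at g t"
  shows "hol_ext_at (\<lambda>x. f x * g x) t"
proof -
  obtain F G where "F analytic_on {of_real t}" "\<forall>\<^sub>F x in nhds t. f x = F (of_real x)"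
    and "G analytic_on {of_real t}" "\<forall>\<^sub>F x in nhds t. g x = G (of_real x)"
    using assms unfolding hol_ext_at_def by blast
  then show ?thesis
    by (intro hol_ext_atI[of "\<lambda>z. F z * G z"])
       (auto intro: analytic_on_mult elim: eventually_elim2)
qed

lemma hol_ext_at_compose:
  assumes "hol_ext_at f t" "F analytic_on {f t}"
  shows "hol_ext_at (\<lambda>x. F (f x)) t"
proof -
  from assms obtain g where g: "g analytic_on {of_real t}"
    and ev: "\<forall>\<^sub>F x in nhds t. f x = g (of_real x)"
    unfolding hol_ext_at_def by blast
  have "f t = g (of_real t)" using ev by (rule eventually_nhds_x_imp_x)
  with g assms(2) have "(F \<circ> g) analytic_on {of_real t}"
    by (intro analytic_on_compose) auto
  then show ?thesis
    by (rule hol_ext_atI) (use ev in \<open>auto elim: eventually_mono\<close>)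
qed

lemma hol_ext_at_compose_real:
  assumes T: "hol_ext_at (\<lambda>x. of_real (T x)) t" and f: "hol_ext_at f (T t)"
    and cont: "isCont T t"
  shows "hol_ext_at (\<lambda>x. f (T x)) t"
proof -
  from f obtain g where g: "g analytic_on {of_real (T t)}"
    and ev: "\<forall>\<^sub>F x in nhds (T t). f x = g (of_real x)"
    unfolding hol_ext_at_def by blast
  have "hol_ext_at (\<lambda>x. g (of_real (T x))) t"
    using T g by (rule hol_ext_at_compose)
  moreover have "\<forall>\<^sub>F x in nhds t. f (T x) = g (of_real (T x))"
    using ev cont unfolding isCont_def tendsto_at_iff_tendsto_nhds
    by (rule eventually_compose_filterlim)
  ultimately show ?thesis by (rule hol_ext_at_cong)
qed

lemma hol_ext_at_derivative:
  assumes "hol_ext_at f t"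
  shows "f differentiable (at t)" "hol_ext_at (\<lambda>x. vector_derivative f (at x)) t"
proof -
  obtain g r where g: "r > 0" "g holomorphic_on ball (of_real t) r"
    "\<And>x. \<bar>x - t\<bar> < r \<Longrightarrow> f x = g (of_real x)"
    using hol_ext_atE[OF assms] by metis
  have der: "(f has_vector_derivative deriv g (of_real x)) (at x)" if x: "\<bar>x - t\<bar> < r" for x
  proof -
    have "complex_of_real x \<in> ball (of_real t) r"
      using x by (simp add: dist_norm abs_minus_commute flip: of_real_diff)
    then have "(g has_field_derivative deriv g (of_real x)) (at (of_real x))"
      using g(2) by (meson holomorphic_derivI open_ball)
    then have "((\<lambda>x. g (of_real x)) has_vector_derivative deriv g (of_real x)) (at x)"
      by (rule has_vector_derivative_real_field)
    then show ?thesis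
      by (rule has_vector_derivative_transform_within_open[where S = "ball t r"])
         (use x g(3) in \<open>auto simp: dist_real_def abs_minus_commute\<close>)
  qed
  show "f differentiable (at t)"
    using der[of t] g(1) by (auto intro: differentiableI_vector)
  show "hol_ext_at (\<lambda>x. vector_derivative f (at x)) t"
  proof (rule hol_ext_atI)
    show "deriv g analytic_on {of_real t}"
      by (rule holomorphic_on_imp_analytic_at[of _ "ball (of_real t) r"])
         (use g in \<open>auto intro: holomorphic_deriv\<close>)
    show "\<forall>\<^sub>F x in nhds t. vector_derivative f (at x) = deriv g (of_real x)"
      unfolding eventually_nhds_metric
      using der g(1) by (auto simp: dist_real_def intro!: exI[of _ r] vector_derivative_at)
  qed
qed

lemma hol_ext_at_antiderivative:
  assumes "hol_ext_at h t" "\<And>x. (T has_vector_derivative h x) (at x)"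
  shows "hol_ext_at T t"
proof -
  obtain g r where g: "r > 0" "g holomorphic_on ball (of_real t) r"
    "\<And>x. \<bar>x - t\<bar> < r \<Longrightarrow> h x = g (of_real x)"
    using hol_ext_atE[OF assms(1)] by metis
  obtain P where P: "\<And>z. z \<in> ball (of_real t) r \<Longrightarrow> (P has_field_derivative g z) (at z)"
    using holomorphic_convex_primitive'[OF _ _ g(2)] by (auto simp: at_within_open[OF _ open_ball])
  define D where "D x = T x - P (of_real x)" for x
  have mem: "complex_of_real x \<in> ball (of_real t) r" if "x \<in> ball t r" for x
    using that by (simp add: dist_norm flip: of_real_diff)
  have D': "(D has_vector_derivative h x - g (of_real x)) (at x)" if "x \<in> ball t r" for x
    unfolding D_def
    using that by (intro has_vector_derivative_diff assms(2) has_vector_derivative_real_field P mem)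
  have D0: "(D has_vector_derivative 0) (at x within ball t r)" if "x \<in> ball t r" for x
  proof -
    have "h x - g (of_real x) = 0"
      using that g(3)[of x] by (simp add: dist_real_def abs_minus_commute)
    with D'[OF that] show ?thesis by (simp add: has_vector_derivative_at_within)
  qed
  obtain c where c: "\<And>x. x \<in> ball t r \<Longrightarrow> D x = c"
    using has_vector_derivative_zero_constant[OF convex_ball D0] by blast
  show ?thesis
  proof (rule hol_ext_atI)
    have "P holomorphic_on ball (of_real t) r"
      using P unfolding holomorphic_on_open[OF open_ball] by blast
    then show "(\<lambda>z. P z + c) analytic_on {of_real t}"
      by (intro holomorphic_on_imp_analytic_at[of _ "ball (of_real t) r"])
         (use g(1) in \<open>auto intro!: holomorphic_intros\<close>)
    show "\<forall>\<^sub>F x in nhds t. T x = P (of_real x) + c"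
      unfolding eventually_nhds_metric
      using c g(1) by (intro exI[of _ r]) (auto simp: D_def dist_commute algebra_simps)
  qed
qed

lemma hol_ext_at_inverse:
  assumes T: "hol_ext_at (\<lambda>x. of_real (T x)) t"
    and der: "(T has_real_derivative T') (at t)" "T' \<noteq> 0"
    and S: "\<And>x. S (T x) = x" "\<And>x. T (S x) = x" "isCont S (T t)"
  shows "hol_ext_at (\<lambda>x. of_real (S x)) (T t)"
proof -
  obtain g r where g: "r > 0" "g holomorphic_on ball (of_real t) r"
    "\<And>x. \<bar>x - t\<bar> < r \<Longrightarrow> of_real (T x) = g (of_real x)"
    using hol_ext_atE[OF T] by metis
  have "deriv g (of_real t) \<noteq> 0"
  proof -
    have "(g has_field_derivative deriv g (of_real t)) (at (of_real t))"
      using g by (intro holomorphic_derivI[OF g(2)]) auto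
    then have "((\<lambda>x. g (of_real x)) has_vector_derivative deriv g (of_real t)) (at t)"
      by (rule has_vector_derivative_real_field)
    then have "((\<lambda>x. of_real (T x)) has_vector_derivative deriv g (of_real t)) (at t)"
      by (rule has_vector_derivative_transform_within_open[where S = "ball t r"])
         (use g(1,3) in \<open>auto simp: dist_real_def abs_minus_commute\<close>)
    moreover have "((\<lambda>x. complex_of_real (T x)) has_vector_derivative of_real T') (at t)"
      using der(1) by (rule has_vector_derivative_of_real)
    ultimately show ?thesis
      using vector_derivative_unique_at der(2) by fastforce
  qed
  then obtain r' where r': "r' > 0" "ball (complex_of_real t) r' \<subseteq> ball (of_real t) r"
    "inj_on g (ball (of_real t) r')"
    using has_complex_derivative_locally_injective[OF g(2) _ open_ball, of "of_real t"] g(1)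
    by (metis centre_in_ball)
  have hol: "g holomorphic_on ball (of_real t) r'"
    using g(2) r'(2) by (rule holomorphic_on_subset)
  obtain k where k: "k holomorphic_on (g ` ball (of_real t) r')"
    "\<And>z. z \<in> ball (of_real t) r' \<Longrightarrow> k (g z) = z"
    using holomorphic_has_inverse[OF hol open_ball r'(3)] by metis
  have op: "open (g ` ball (of_real t) r')"
    using hol r'(3) by (intro open_mapping_thm3) auto
  have gt: "g (of_real t) = of_real (T t)" using g(1) g(3)[of t] by simp
  show ?thesis
  proof (rule hol_ext_atI)
    show "k analytic_on {of_real (T t)}"
      by (rule holomorphic_on_imp_analytic_at[OF k(1) op]) (use gt r'(1) in \<open>auto intro!: image_eqI[of _ _ "of_real t"]\<close>)
    have "\<forall>\<^sub>F y in nhds (T t). S y \<in> ball t r'"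
      using topological_tendstoD[of S "S (T t)" "nhds (T t)" "ball t r'"] S(3) r'(1)
      unfolding isCont_def tendsto_at_iff_tendsto_nhds by (simp add: S(1))
    then show "\<forall>\<^sub>F y in nhds (T t). of_real (S y) = k (of_real y)"
    proof eventually_elim
      case (elim y)
      then have m: "complex_of_real (S y) \<in> ball (of_real t) r'"
        by (simp add: dist_norm flip: of_real_diff)
      then have "complex_of_real (S y) \<in> ball (of_real t) r" using r'(2) by blast
      then have "\<bar>S y - t\<bar> < r" by (simp add: dist_norm abs_minus_commute flip: of_real_diff)
      then have "g (of_real (S y)) = of_real y" using g(3)[of "S y"] S(2) by simp
      then show ?case using k(2)[OF m] by simp
    qed
  qed
qed

lemma real_analytic_majorant:
  fixes f :: "'a::euclidean_space \<Rightarrow> 'b::euclidean_space"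
  assumes f: "real_analytic_on f S" and x: "x \<in> S"
  obtains r \<rho> c where "r > 0" "\<rho> > 0"
    "\<forall>y\<in>ball x r. ((\<lambda>\<alpha>. (\<Prod>b\<in>Basis. ((y - x) \<bullet> b) ^ \<alpha> b) * c \<alpha>) has_sum (f y \<bullet> e))
       (Basis \<rightarrow>\<^sub>E (UNIV :: nat set))"
    "(\<lambda>\<alpha>. (\<Prod>b\<in>(Basis :: 'a set). \<rho> ^ \<alpha> b) * \<bar>c \<alpha>\<bar>) summable_on (Basis \<rightarrow>\<^sub>E (UNIV :: nat set))"
proof -
  let ?I = "Basis \<rightarrow>\<^sub>E (UNIV :: nat set) :: ('a \<Rightarrow> nat) set"
  from f x obtain r c where r: "r > 0" and
    sum: "\<And>y. y \<in> ball x r \<Longrightarrow>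
      ((\<lambda>\<alpha>. (\<Prod>b\<in>Basis. ((y - x) \<bullet> b) ^ \<alpha> b) *\<^sub>R c \<alpha>) has_sum f y) ?I"
    unfolding real_analytic_on_def by blast
  have sum_e: "((\<lambda>\<alpha>. (\<Prod>b\<in>Basis. ((y - x) \<bullet> b) ^ \<alpha> b) * (c \<alpha> \<bullet> e)) has_sum (f y \<bullet> e)) ?I"
    if "y \<in> ball x r" for y
    using has_sum_bounded_linear[OF bounded_linear_inner_left sum[OF that], of e]
    by (simp add: o_def)
  define \<rho> where "\<rho> = r / (2 * real (DIM('a)))"
  have \<rho>: "\<rho> > 0" using r by (simp add: \<rho>_def)
  define y0 where "y0 = x + \<rho> *\<^sub>R (\<Sum>b\<in>Basis. b)"
  have "norm (\<rho> *\<^sub>R (\<Sum>b\<in>Basis. b::'a)) \<le> \<rho> * real DIM('a)"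
    using norm_sum[of "\<lambda>b. b" "Basis::'a set"] \<rho> by simp
  also have "\<dots> < r" using r by (simp add: \<rho>_def)
  finally have y0: "y0 \<in> ball x r" by (simp add: y0_def dist_norm)
  have y0b: "(y0 - x) \<bullet> b = \<rho>" if "b \<in> Basis" for b
    using that by (simp add: y0_def inner_sum_left inner_Basis)
  define M where "M \<alpha> = (\<Prod>b\<in>Basis. \<rho> ^ \<alpha> b) * \<bar>c \<alpha> \<bullet> e\<bar>" for \<alpha> :: "'a \<Rightarrow> nat"
  have "(\<lambda>\<alpha>. (\<Prod>b\<in>Basis. ((y0 - x) \<bullet> b) ^ \<alpha> b) * (c \<alpha> \<bullet> e)) summable_on ?I"
    using sum_e[OF y0] by (rule has_sum_imp_summable)
  then have "(\<lambda>\<alpha>. norm ((\<Prod>b\<in>Basis. ((y0 - x) \<bullet> b) ^ \<alpha> b) * (c \<alpha> \<bullet> e))) summable_on ?I"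
    by (rule summable_on_iff_abs_summable_on_real[THEN iffD1])
  moreover have "norm ((\<Prod>b\<in>Basis. ((y0 - x) \<bullet> b) ^ \<alpha> b) * (c \<alpha> \<bullet> e)) = M \<alpha>" for \<alpha>
    using \<rho> by (simp add: M_def abs_mult abs_prod y0b power_abs)
  ultimately have M: "M summable_on ?I"
    by simp
  show thesis
    using that[OF r \<rho> _ M[unfolded M_def]] sum_e by blast
qed

lemma real_analytic_isCont:
  fixes f :: "'a::euclidean_space \<Rightarrow> 'b::euclidean_space"
  assumes f: "real_analytic_on f S" and x: "x \<in> S"
  shows "isCont f x"
proof -
  let ?I = "Basis \<rightarrow>\<^sub>E (UNIV :: nat set) :: ('a \<Rightarrow> nat) set"
  have "isCont (\<lambda>y. f y \<bullet> e) x" for e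
  proof -
    obtain r \<rho> c where r: "r > 0" and \<rho>: "\<rho> > 0"
      and sum: "\<forall>y\<in>ball x r.
        ((\<lambda>\<alpha>. (\<Prod>b\<in>Basis. ((y - x) \<bullet> b) ^ \<alpha> b) * c \<alpha>) has_sum (f y \<bullet> e)) ?I"
      and M: "(\<lambda>\<alpha>. (\<Prod>b\<in>(Basis :: 'a set). \<rho> ^ \<alpha> b) * \<bar>c \<alpha>\<bar>) summable_on ?I"
      using real_analytic_majorant[OF f x, of e] .
    define V where "V = ball x (min r \<rho>)"
    have "uniform_limit V (\<lambda>X y. \<Sum>\<alpha>\<in>X. (\<Prod>b\<in>Basis. ((y - x) \<bullet> b) ^ \<alpha> b) * c \<alpha>)
       (\<lambda>y. f y \<bullet> e) (finite_subsets_at_top ?I)"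
    proof (rule Weierstrass_m_test_general'[OF _ _ M])
      fix \<alpha> :: "'a \<Rightarrow> nat" and y assume "y \<in> V"
      then have "norm (y - x) \<le> \<rho>" by (simp add: V_def dist_norm norm_minus_commute)
      then have "norm (\<Prod>b\<in>Basis. ((y - x) \<bullet> b) ^ \<alpha> b) \<le> (\<Prod>b\<in>(Basis :: 'a set). \<rho> ^ \<alpha> b)"
        unfolding prod_norm[symmetric] norm_power
        by (intro prod_mono conjI power_mono) (auto intro: order_trans[OF Basis_le_norm])
      then show "norm ((\<Prod>b\<in>Basis. ((y - x) \<bullet> b) ^ \<alpha> b) * c \<alpha>) \<le> (\<Prod>b\<in>(Basis :: 'a set). \<rho> ^ \<alpha> b) * \<bar>c \<alpha>\<bar>"
        unfolding real_norm_def abs_mult by (rule mult_right_mono) simp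
    qed (use sum in \<open>auto simp: V_def\<close>)
    then have "continuous_on V (\<lambda>y. f y \<bullet> e)"
      by (rule uniform_limit_theorem[rotated]) (auto intro!: always_eventually continuous_intros)
    then show ?thesis
      using r \<rho> by (auto simp: V_def continuous_on_eq_continuous_at)
  qed
  then show ?thesis by (simp add: continuous_componentwise[of _ f])
qed

lemma hol_ext_at_real_analytic:
  fixes f :: "'a::euclidean_space \<Rightarrow> 'b::euclidean_space" and \<gamma> :: "real \<Rightarrow> 'a"
  assumes f: "real_analytic_on f S" and t: "\<gamma> t \<in> S"
    and \<gamma>: "\<And>b. b \<in> Basis \<Longrightarrow> hol_ext_at (\<lambda>s. of_real (\<gamma> s \<bullet> b)) t"
    and cont: "isCont \<gamma> t"
  shows "hol_ext_at (\<lambda>s. of_real (f (\<gamma> s) \<bullet> e)) t"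
proof -
  define x where "x = \<gamma> t"
  let ?I = "Basis \<rightarrow>\<^sub>E (UNIV :: nat set) :: ('a \<Rightarrow> nat) set"
  obtain r \<rho> c where r: "r > 0" and \<rho>: "\<rho> > 0"
    and sum_e: "\<forall>y\<in>ball x r.
      ((\<lambda>\<alpha>. (\<Prod>b\<in>Basis. ((y - x) \<bullet> b) ^ \<alpha> b) * c \<alpha>) has_sum (f y \<bullet> e)) ?I"
    and M': "(\<lambda>\<alpha>. (\<Prod>b\<in>(Basis :: 'a set). \<rho> ^ \<alpha> b) * \<bar>c \<alpha>\<bar>) summable_on ?I"
    using real_analytic_majorant[OF f t[folded x_def], of e] .
  define M where "M \<alpha> = (\<Prod>b\<in>Basis. \<rho> ^ \<alpha> b) * \<bar>c \<alpha>\<bar>" for \<alpha> :: "'a \<Rightarrow> nat"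
  have M: "M summable_on ?I" using M' unfolding M_def[abs_def] .
  have "\<forall>b\<in>Basis. \<exists>g r. r > 0 \<and> g holomorphic_on ball (of_real t) r \<and>
     (\<forall>s. \<bar>s - t\<bar> < r \<longrightarrow> of_real (\<gamma> s \<bullet> b) = g (of_real s))"
    using hol_ext_atE[OF \<gamma>] by metis
  then obtain g r1 where g: "\<And>b. b \<in> Basis \<Longrightarrow> r1 b > 0"
    "\<And>b. b \<in> Basis \<Longrightarrow> g b holomorphic_on ball (of_real t) (r1 b)"
    "\<And>b s. b \<in> Basis \<Longrightarrow> \<bar>s - t\<bar> < r1 b \<Longrightarrow> of_real (\<gamma> s \<bullet> b) = g b (of_real s)"
    by metis
  have "\<forall>b\<in>Basis. \<exists>d>0. \<forall>z. dist z (complex_of_real t) < d \<longrightarrow> dist (g b z) (g b (of_real t)) < \<rho>"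
  proof
    fix b :: 'a assume b: "b \<in> Basis"
    have "isCont (g b) (of_real t)"
      using holomorphic_on_imp_continuous_on[OF g(2)[OF b]] g(1)[OF b]
      by (simp add: continuous_on_eq_continuous_at)
    then show "\<exists>d>0. \<forall>z. dist z (complex_of_real t) < d \<longrightarrow> dist (g b z) (g b (of_real t)) < \<rho>"
      using \<rho> unfolding continuous_at_eps_delta by blast
  qed
  then obtain d where d: "\<And>b. b \<in> Basis \<Longrightarrow> d b > 0"
    "\<And>b z. b \<in> Basis \<Longrightarrow> dist z (complex_of_real t) < d b \<Longrightarrow> dist (g b z) (g b (of_real t)) < \<rho>"
    by metis
  define q where "q = Min ((\<lambda>b. min (r1 b) (d b)) ` Basis) / 2"
  have q: "q > 0" unfolding q_def using g(1) d(1) by (simp add: Min_gr_iff)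
  have qb: "q < r1 b" "q < d b" if "b \<in> Basis" for b
  proof -
    have "Min ((\<lambda>b. min (r1 b) (d b)) ` Basis) \<le> min (r1 b) (d b)"
      using that by (intro Min_le) auto
    then have "2 * q \<le> min (r1 b) (d b)" unfolding q_def by simp
    then show "q < r1 b" "q < d b" using q by auto
  qed
  define u where "u \<alpha> z = (\<Prod>b\<in>Basis. (g b z - g b (of_real t)) ^ \<alpha> b) * of_real (c \<alpha>)"
    for \<alpha> :: "'a \<Rightarrow> nat" and z
  have holg: "g b holomorphic_on cball (of_real t) q" if "b \<in> Basis" for b
    using g(2)[OF that] by (rule holomorphic_on_subset) (use qb[OF that] in auto)
  have holu: "u \<alpha> holomorphic_on cball (of_real t) q" for \<alpha>
    unfolding u_def by (intro holomorphic_intros holg)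
  have ul: "uniform_limit (cball (of_real t) q) (\<lambda>X z. \<Sum>\<alpha>\<in>X. u \<alpha> z) (\<lambda>z. \<Sum>\<^sub>\<infinity>\<alpha>\<in>?I. u \<alpha> z)
     (finite_subsets_at_top ?I)"
  proof (rule Weierstrass_m_test_general[OF _ M])
    fix \<alpha> :: "'a \<Rightarrow> nat" and z assume z: "z \<in> cball (complex_of_real t) q"
    have "norm (\<Prod>b\<in>Basis. (g b z - g b (of_real t)) ^ \<alpha> b) \<le> (\<Prod>b\<in>Basis. \<rho> ^ \<alpha> b)"
      unfolding prod_norm[symmetric] norm_power
    proof (intro prod_mono conjI power_mono)
      fix b :: 'a assume b: "b \<in> Basis"
      show "cmod (g b z - g b (of_real t)) \<le> \<rho>"
        using d(2)[OF b, of z] qb(2)[OF b] z by (auto simp: dist_norm norm_minus_commute)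
    qed auto
    then show "norm (u \<alpha> z) \<le> M \<alpha>"
      unfolding u_def M_def norm_mult using \<rho> by (intro mult_mono) (auto intro!: prod_nonneg)
  qed
  have "(\<lambda>z. \<Sum>\<^sub>\<infinity>\<alpha>\<in>?I. u \<alpha> z) holomorphic_on ball (of_real t) q"
  proof (rule holomorphic_uniform_limit[OF _ ul])
    show "\<forall>\<^sub>F X in finite_subsets_at_top ?I. continuous_on (cball (of_real t) q) (\<lambda>z. \<Sum>\<alpha>\<in>X. u \<alpha> z) \<and>
        (\<lambda>z. \<Sum>\<alpha>\<in>X. u \<alpha> z) holomorphic_on ball (of_real t) q"
      by (intro always_eventually allI conjI holomorphic_on_imp_continuous_on holomorphic_on_sum
         holu holomorphic_on_subset[OF holu]) auto
  qed auto
  then have an: "(\<lambda>z. \<Sum>\<^sub>\<infinity>\<alpha>\<in>?I. u \<alpha> z) analytic_on {of_real t}"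
    by (rule holomorphic_on_imp_analytic_at) (use q in auto)
  have ev1: "\<forall>\<^sub>F s in nhds t. s \<in> ball t q"
    by (rule eventually_nhds_in_open) (use q in auto)
  have "\<forall>\<^sub>F s in nhds t. \<gamma> s \<in> ball x r"
    using cont r unfolding isCont_def tendsto_at_iff_tendsto_nhds x_def
    by (intro topological_tendstoD) auto
  with ev1 have "\<forall>\<^sub>F s in nhds t. of_real (f (\<gamma> s) \<bullet> e) = (\<Sum>\<^sub>\<infinity>\<alpha>\<in>?I. u \<alpha> (of_real s))"
  proof eventually_elim
    case (elim s)
    have eq: "of_real (\<gamma> s \<bullet> b) - of_real (x \<bullet> b) = g b (of_real s) - g b (of_real t)"
      if "b \<in> Basis" for b
      using g(3)[OF that, of s] g(3)[OF that, of t] qb(1)[OF that] elim(1) g(1)[OF that]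
      by (auto simp: x_def dist_real_def abs_minus_commute)
    have "((\<lambda>\<alpha>. complex_of_real ((\<Prod>b\<in>Basis. ((\<gamma> s - x) \<bullet> b) ^ \<alpha> b) * (c \<alpha>)))
       has_sum of_real (f (\<gamma> s) \<bullet> e)) ?I"
      using has_sum_of_real[OF bspec[OF sum_e elim(2)]] .
    moreover have "complex_of_real ((\<Prod>b\<in>Basis. ((\<gamma> s - x) \<bullet> b) ^ \<alpha> b) * (c \<alpha>)) = u \<alpha> (of_real s)" for \<alpha>
      unfolding u_def of_real_mult of_real_prod of_real_power inner_diff_left of_real_diff
      by (simp add: eq)
    ultimately show ?case by (simp add: infsumI)
  qed
  with an show ?thesis by (rule hol_ext_atI)
qed

section \<open>Conformal maps of a strip\<close>

definition strip :: "real \<Rightarrow> complex set" where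
  "strip \<delta> = {z. \<bar>Im z\<bar> < \<delta>}"

lemma strip_iff: "z \<in> strip \<delta> \<longleftrightarrow> \<bar>Im z\<bar> < \<delta>"
  by (simp add: strip_def)

lemma open_strip: "open (strip \<delta>)"
proof -
  have "strip \<delta> = Im -` {-\<delta><..<\<delta>}" by (auto simp: strip_def)
  then show ?thesis by (simp add: open_vimage continuous_on_Im continuous_on_id)
qed

lemma convex_strip: "convex (strip \<delta>)"
proof -
  have "strip \<delta> = Im -` {-\<delta><..<\<delta>}" by (auto simp: strip_def)
  then show ?thesis by (simp add: convex_linear_vimage linear_conv_bounded_linear bounded_linear_Im)
qed

lemma holomorphic_eq_on_reals:
  assumes "F holomorphic_on S" "G holomorphic_on S" "open S" "connected S"
    and a: "complex_of_real a \<in> S"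
    and eq: "\<And>x. complex_of_real x \<in> S \<Longrightarrow> F (of_real x) = G (of_real x)"
    and z: "z \<in> S"
  shows "F z = G z"
proof -
  obtain \<eta> where \<eta>: "\<eta> > 0" "ball (complex_of_real a) \<eta> \<subseteq> S"
    using \<open>open S\<close> a open_contains_ball by blast
  have "complex_of_real a islimpt of_real ` {x. complex_of_real x \<in> S}"
    unfolding islimpt_approachable
  proof (intro allI impI)
    fix e :: real assume e: "e > 0"
    define x where "x = a + min e \<eta> / 2"
    have "dist (complex_of_real x) (of_real a) = min e \<eta> / 2"
      using e \<eta>(1) by (simp add: x_def dist_norm)
    moreover from this have "complex_of_real x \<in> S"
      using \<eta> e by (intro subsetD[OF \<eta>(2)]) (auto simp: dist_commute)
    ultimately show "\<exists>x'\<in>of_real ` {x. complex_of_real x \<in> S}.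
        x' \<noteq> of_real a \<and> dist x' (complex_of_real a) < e"
      using e \<eta>(1) by (intro bexI[of _ "of_real x"]) auto
  qed
  from analytic_continuation[OF holomorphic_on_diff[OF assms(1,2)] assms(3,4) _ a this _ z]
  have "F z - G z = 0"
    using eq by auto
  then show ?thesis by simp
qed

lemma periodic_int:
  fixes f :: "real \<Rightarrow> 'a"
  assumes "\<And>t. f (t + 1) = f t"
  shows "f (t + of_int n) = f t"
proof (induction n rule: int_induct[of _ 0])
  case (step1 i)
  then show ?case using assms[of "t + of_int i"] by (simp add: add.assoc)
next
  case (step2 i)
  then show ?case using assms[of "t + of_int (i - 1)"] by (simp add: algebra_simps)
qed simp

lemma periodic_hol_extension:
  assumes ext: "\<And>t. hol_ext_at f t" and per: "\<And>t. f (t + 1) = f t"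
  obtains \<delta> F where "\<delta> > 0" "F holomorphic_on strip \<delta>" "\<And>x. F (of_real x) = f x"
    "\<And>z. z \<in> strip \<delta> \<Longrightarrow> F (z + 1) = F z"
proof -
  have "\<exists>g r. r > 0 \<and> g holomorphic_on ball (complex_of_real t) r \<and>
     (\<forall>x. \<bar>x - t\<bar> < r \<longrightarrow> f x = g (of_real x))" for t
    using hol_ext_atE[OF ext[of t]] by metis
  then obtain g r where g: "\<And>t. r t > 0" "\<And>t. g t holomorphic_on ball (complex_of_real t) (r t)"
     "\<And>t x. \<bar>x - t\<bar> < r t \<Longrightarrow> f x = g t (of_real x)"
    by metis
  obtain \<epsilon> where \<epsilon>: "\<epsilon> > 0" "\<And>x. x \<in> of_real ` {0..1} \<Longrightarrow>
      \<exists>G \<in> range (\<lambda>t. ball (complex_of_real t) (r t)). ball x \<epsilon> \<subseteq> G"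
  proof (rule Heine_Borel_lemma[of "complex_of_real ` {0..1}"])
    show "compact (complex_of_real ` {0..1})"
      by (intro compact_continuous_image continuous_intros) auto
    show "complex_of_real ` {0..1} \<subseteq> \<Union> (range (\<lambda>t. ball (complex_of_real t) (r t)))"
      by (auto, metis dist_self g(1))
  qed auto
  have "\<exists>G. G holomorphic_on ball (complex_of_real s) \<epsilon> \<and>
      (\<forall>x. \<bar>x - s\<bar> < \<epsilon> \<longrightarrow> G (of_real x) = f x)" for s
  proof -
    define s' where "s' = s - of_int \<lfloor>s\<rfloor>"
    have "s' \<in> {0..1}" unfolding s'_def by (auto simp: le_diff_eq) linarith+
    then obtain t where t: "ball (complex_of_real s') \<epsilon> \<subseteq> ball (complex_of_real t) (r t)"
      using \<epsilon>(2)[of "of_real s'"] by blast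
    have h: "g t holomorphic_on ball (of_real s') \<epsilon>"
      using g(2) t by (rule holomorphic_on_subset)
    show ?thesis
    proof (intro exI[of _ "\<lambda>z. g t (z - of_int \<lfloor>s\<rfloor>)"] conjI allI impI)
      have "(g t \<circ> (\<lambda>z. z - of_int \<lfloor>s\<rfloor>)) holomorphic_on ball (complex_of_real s) \<epsilon>"
        by (rule holomorphic_on_compose_gen[OF _ h])
           (auto intro!: holomorphic_intros simp: s'_def dist_norm algebra_simps)
      then show "(\<lambda>z. g t (z - of_int \<lfloor>s\<rfloor>)) holomorphic_on ball (complex_of_real s) \<epsilon>"
        by (simp add: o_def)
      fix x assume x: "\<bar>x - s\<bar> < \<epsilon>"
      define x' where "x' = x - of_int \<lfloor>s\<rfloor>"
      have "complex_of_real x' \<in> ball (complex_of_real s') \<epsilon>"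
        using x by (simp add: dist_norm x'_def s'_def abs_minus_commute flip: of_real_diff)
      with t have "complex_of_real x' \<in> ball (of_real t) (r t)" by blast
      then have "\<bar>x' - t\<bar> < r t"
        by (simp add: dist_norm abs_minus_commute flip: of_real_diff)
      then have "f x' = g t (of_real x')" by (rule g(3))
      moreover have "f x' = f x"
        using periodic_int[of f x' "\<lfloor>s\<rfloor>"] per by (simp add: x'_def)
      ultimately show "g t (of_real x - of_int \<lfloor>s\<rfloor>) = f x" by (simp add: x'_def)
    qed
  qed
  then obtain G where G: "\<And>s. G s holomorphic_on ball (complex_of_real s) \<epsilon>"
    "\<And>s x. \<bar>x - s\<bar> < \<epsilon> \<Longrightarrow> G s (of_real x) = f x"
    by metis
  define F where "F z = G (Re z) z" for z
  have FG: "F z = G s z" if z: "z \<in> ball (complex_of_real s) \<epsilon>" for s z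
  proof -
    let ?S = "ball (complex_of_real s) \<epsilon> \<inter> ball (complex_of_real (Re z)) \<epsilon>"
    have "norm (of_real (Re z) - z) \<le> norm (of_real s - z)"
      by (simp add: cmod_def)
    moreover have "\<bar>Re z - s\<bar> \<le> norm (z - of_real s)"
      using abs_Re_le_cmod[of "z - of_real s"] by simp
    ultimately have m: "z \<in> ?S" "complex_of_real (Re z) \<in> ?S"
      using z \<epsilon>(1) by (auto simp: dist_norm norm_minus_commute simp flip: of_real_diff)
    show ?thesis
      unfolding F_def
    proof (rule holomorphic_eq_on_reals[where F = "G (Re z)" and G = "G s" and S = ?S and a = "Re z"])
      show "G (Re z) holomorphic_on ?S" "G s holomorphic_on ?S"
        by (rule holomorphic_on_subset[OF G(1)]; blast)+
      show "connected ?S" by (intro convex_connected convex_Int convex_ball)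
      fix x assume "complex_of_real x \<in> ?S"
      then have "\<bar>x - Re z\<bar> < \<epsilon>" "\<bar>x - s\<bar> < \<epsilon>"
        by (auto simp: dist_norm abs_minus_commute simp flip: of_real_diff)
      then show "G (Re z) (of_real x) = G s (of_real x)" by (simp add: G(2))
    qed (use m in auto)
  qed
  show thesis
  proof (rule that[of \<epsilon> F])
    show hol: "F holomorphic_on strip \<epsilon>"
    proof -
      have "strip \<epsilon> = (\<Union>s. ball (complex_of_real s) \<epsilon>)"
      proof (intro set_eqI iffI)
        fix z assume "z \<in> strip \<epsilon>"
        then have "z \<in> ball (of_real (Re z)) \<epsilon>" by (simp add: strip_def dist_norm cmod_def)
        then show "z \<in> (\<Union>s. ball (complex_of_real s) \<epsilon>)" by blast
      next
        fix z assume "z \<in> (\<Union>s. ball (complex_of_real s) \<epsilon>)"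
        then obtain s where "norm (z - of_real s) < \<epsilon>" by (auto simp: dist_norm norm_minus_commute)
        then show "z \<in> strip \<epsilon>"
          using abs_Im_le_cmod[of "z - of_real s"] by (simp add: strip_def)
      qed
      moreover have "F holomorphic_on ball (of_real s) \<epsilon>" for s
        using G(1)[of s] by (rule holomorphic_transform) (simp add: FG)
      ultimately show ?thesis
        by (auto intro!: holomorphic_on_UN_open)
    qed
    show Ff: "F (of_real x) = f x" for x
      using FG[of "of_real x" x] G(2)[of x x] \<epsilon>(1) by simp
    fix z assume z: "z \<in> strip \<epsilon>"
    have "(F \<circ> (\<lambda>z. z + 1)) holomorphic_on strip \<epsilon>"
      by (rule holomorphic_on_compose_gen[OF _ hol]) (auto simp: strip_def intro!: holomorphic_intros)
    then have hol1: "(\<lambda>z. F (z + 1)) holomorphic_on strip \<epsilon>" by (simp add: o_def)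
    show "F (z + 1) = F z"
    proof (rule holomorphic_eq_on_reals[OF hol1 hol open_strip convex_connected[OF convex_strip] _ _ z])
      show "complex_of_real 0 \<in> strip \<epsilon>" using \<epsilon>(1) by (simp add: strip_def)
      fix x :: real
      have "F (of_real x + 1) = F (of_real (x + 1))" by simp
      then show "F (of_real x + 1) = F (of_real x)" by (simp only: Ff per)
    qed
  qed (use \<epsilon> in auto)
qed

lemma periodic_strip_int:
  assumes "\<And>z. z \<in> strip \<delta> \<Longrightarrow> F (z + 1) = F z" "z \<in> strip \<delta>"
  shows "F (z + of_int n) = F z"
proof -
  have s: "z + of_int i \<in> strip \<delta>" for i using assms(2) by (simp add: strip_def)
  show ?thesis
  proof (induction n rule: int_induct[of _ 0])
    case (step1 i)
    then show ?case using assms(1)[OF s, of i] by (simp add: add.assoc)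
  next
    case (step2 i)
    then show ?case using assms(1)[OF s, of "i - 1"] by (simp add: algebra_simps)
  qed simp
qed

lemma strip_injective_mod_int:
  assumes \<delta>: "\<delta> > 0" and hol: "F holomorphic_on strip \<delta>"
    and per: "\<And>z. z \<in> strip \<delta> \<Longrightarrow> F (z + 1) = F z"
    and der: "\<And>x. deriv F (of_real x) \<noteq> 0"
    and inj: "\<And>x y. F (of_real x) = F (of_real y) \<Longrightarrow> \<exists>n::int. y = x + of_int n"
  obtains \<delta>' where "0 < \<delta>'" "\<delta>' \<le> \<delta>"
    "\<forall>z\<in>strip \<delta>'. \<forall>w\<in>strip \<delta>'. F z = F w \<longrightarrow> (\<exists>n::int. w = z + of_int n)"
proof (rule ccontr)
  assume "\<not> thesis"
  with that have neg: "\<not> (\<forall>z w. z \<in> strip d \<longrightarrow> w \<in> strip d \<longrightarrow> F z = F w \<longrightarrow> (\<exists>n::int. w = z + of_int n))"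
    if "0 < d" "d \<le> \<delta>" for d
    using that by blast
  define d where "d m = \<delta> / (real m + 2)" for m :: nat
  have d: "0 < d m" "d m \<le> \<delta> / 2" for m using \<delta> by (auto simp: d_def field_simps)
  have "\<exists>z w. z \<in> strip (d m) \<and> w \<in> strip (d m) \<and> F z = F w \<and> z \<noteq> w \<and>
     \<bar>Re z\<bar> \<le> 2 \<and> \<bar>Re w\<bar> \<le> 2 \<and> \<bar>Re w - Re z\<bar> \<le> 1/2" for m
  proof -
    have dd: "d m \<le> \<delta>" using d(2)[of m] \<delta> by simp
    obtain z w where zw: "z \<in> strip (d m)" "w \<in> strip (d m)" "F z = F w" "\<And>n::int. w \<noteq> z + of_int n"
      using neg[OF d(1)[of m] dd] by blast
    define z' where "z' = z + of_int (- \<lfloor>Re z\<rfloor>)"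
    define w' where "w' = w + of_int (- round (Re w - Re z'))"
    have "strip (d m) \<subseteq> strip \<delta>" using dd by (auto simp: strip_def)
    then have "F z' = F z" "F w' = F w"
      unfolding z'_def w'_def using zw by (blast intro: periodic_strip_int[where F = F and \<delta> = \<delta>, OF per])+
    moreover have "z' \<noteq> w'"
    proof
      assume "z' = w'"
      then have "w = z + of_int (round (Re w - Re z') - \<lfloor>Re z\<rfloor>)"
        by (simp add: z'_def w'_def algebra_simps)
      then show False using zw(4) by blast
    qed
    moreover have "0 \<le> Re z'" "Re z' \<le> 1" unfolding z'_def by (simp_all add: algebra_simps) linarith+
    moreover have "\<bar>Re w' - Re z'\<bar> \<le> 1/2"
      using of_int_round_abs_le[of "Re w - Re z'"] by (simp add: w'_def algebra_simps abs_minus_commute)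
    moreover have "z' \<in> strip (d m)" "w' \<in> strip (d m)"
      using zw by (auto simp: strip_def z'_def w'_def)
    ultimately show ?thesis
      using zw(3) by (intro exI[of _ z'] exI[of _ w'] conjI; linarith?) auto
  qed
  then obtain Z W where ZW: "\<And>m. Z m \<in> strip (d m)" "\<And>m. W m \<in> strip (d m)" "\<And>m. F (Z m) = F (W m)"
    "\<And>m. Z m \<noteq> W m" "\<And>m. \<bar>Re (Z m)\<bar> \<le> 2" "\<And>m. \<bar>Re (W m)\<bar> \<le> 2" "\<And>m. \<bar>Re (W m) - Re (Z m)\<bar> \<le> 1/2"
    by metis
  define K where "K = cbox (Complex (-2) (-\<delta>/2)) (Complex 2 (\<delta>/2))"
  have K: "Z m \<in> K" "W m \<in> K" for m
    using ZW(1,2,5,6)[of m] d(2)[of m] by (auto simp: K_def in_cbox_complex_iff strip_def)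
  have KS: "K \<subseteq> strip \<delta>" using \<delta> by (auto simp: K_def in_cbox_complex_iff strip_def)
  have "compact (K \<times> K)" unfolding K_def by (intro compact_Times) auto
  moreover have "\<forall>m. (Z m, W m) \<in> K \<times> K" using K by auto
  ultimately obtain zw \<sigma> where \<sigma>: "zw \<in> K \<times> K" "strict_mono \<sigma>" "((\<lambda>m. (Z m, W m)) \<circ> \<sigma>) \<longlonglongrightarrow> zw"
    unfolding compact_def by (metis (no_types, lifting))
  obtain z w where zw: "zw = (z, w)" by (cases zw)
  have Zl: "(\<lambda>m. Z (\<sigma> m)) \<longlonglongrightarrow> z" and Wl: "(\<lambda>m. W (\<sigma> m)) \<longlonglongrightarrow> w"
    using tendsto_fst[OF \<sigma>(3)] tendsto_snd[OF \<sigma>(3)] by (simp_all add: zw o_def)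
  have zK: "z \<in> K" "w \<in> K" using \<sigma>(1) zw by auto
  have d0: "(\<lambda>m. d (\<sigma> m)) \<longlonglongrightarrow> 0"
  proof -
    have "d \<longlonglongrightarrow> 0" unfolding d_def by real_asymp
    then show ?thesis using LIMSEQ_subseq_LIMSEQ[OF _ \<sigma>(2)] by (simp add: o_def)
  qed
  have Im0: "Im z = 0" "Im w = 0"
  proof -
    have "(\<lambda>m. Im (Z (\<sigma> m))) \<longlonglongrightarrow> 0" "(\<lambda>m. Im (W (\<sigma> m))) \<longlonglongrightarrow> 0"
      using ZW(1,2) by (auto intro!: Lim_null_comparison[OF always_eventually d0] less_imp_le simp: strip_def)
    then show "Im z = 0" "Im w = 0"
      using tendsto_Im[OF Zl] tendsto_Im[OF Wl] LIMSEQ_unique by blast+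
  qed
  have cont: "isCont F x" if "x \<in> K" for x
    using holomorphic_on_imp_continuous_on[OF hol] KS that open_strip
    by (auto simp: continuous_on_eq_continuous_at)
  have "(\<lambda>m. F (Z (\<sigma> m))) \<longlonglongrightarrow> F z" "(\<lambda>m. F (W (\<sigma> m))) \<longlonglongrightarrow> F w"
    using isCont_tendsto_compose[OF cont Zl] isCont_tendsto_compose[OF cont Wl] zK by auto
  then have "F z = F w" using ZW(3) LIMSEQ_unique by simp
  moreover have z_eq: "z = of_real (Re z)" "w = of_real (Re w)"
    using Im0 by (simp_all add: complex_eq_iff)
  ultimately obtain n :: int where n: "Re w = Re z + of_int n" using inj by metis
  have "(\<lambda>m. \<bar>Re (W (\<sigma> m)) - Re (Z (\<sigma> m))\<bar>) \<longlonglongrightarrow> \<bar>Re w - Re z\<bar>"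
    by (intro tendsto_intros Zl Wl)
  then have "\<bar>Re w - Re z\<bar> \<le> 1/2"
    by (rule tendsto_upperbound) (use ZW(7) in auto)
  then have "n = 0" using n by simp
  then have "w = z" using n Im0 by (simp add: complex_eq_iff)
  have "deriv F z \<noteq> 0" using der z_eq(1) by metis
  then obtain \<rho> where \<rho>: "\<rho> > 0" "inj_on F (ball z \<rho>)"
    using has_complex_derivative_locally_injective[OF hol _ open_strip] zK KS by blast
  have "\<forall>\<^sub>F m in sequentially. Z (\<sigma> m) \<in> ball z \<rho>" "\<forall>\<^sub>F m in sequentially. W (\<sigma> m) \<in> ball z \<rho>"
    using topological_tendstoD[OF Zl, of "ball z \<rho>"] topological_tendstoD[OF Wl, of "ball z \<rho>"]
      \<rho>(1) \<open>w = z\<close> by auto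
  then have "\<forall>\<^sub>F m in sequentially. False"
  proof eventually_elim
    case (elim m)
    then show False using \<rho>(2) ZW(3,4)[of "\<sigma> m"] by (meson inj_onD)
  qed
  then show False by simp
qed

section \<open>The plane as complex numbers\<close>

definition plane_of :: "complex \<Rightarrow> real^2" where
  "plane_of z = vector [Re z, Im z]"

definition complex_of :: "real^2 \<Rightarrow> complex" where
  "complex_of v = Complex (v $ 1) (v $ 2)"

lemma plane_of_nth [simp]: "plane_of z $ 1 = Re z" "plane_of z $ 2 = Im z"
  by (simp_all add: plane_of_def)

lemma complex_of_sel [simp]: "Re (complex_of v) = v $ 1" "Im (complex_of v) = v $ 2"
  by (simp_all add: complex_of_def)

lemma plane_of_complex_of [simp]: "plane_of (complex_of v) = v"
  by (simp add: vec_eq_iff forall_2)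

lemma complex_of_plane_of [simp]: "complex_of (plane_of z) = z"
  by (simp add: complex_eq_iff)

lemma plane_of_eq_iff [simp]: "plane_of z = plane_of w \<longleftrightarrow> z = w"
  by (metis complex_of_plane_of)

lemma norm_plane_of [simp]: "norm (plane_of z) = cmod z"
  by (simp add: norm_vec_def L2_set_def sum_2 cmod_def)

lemma bounded_linear_plane_of: "bounded_linear plane_of"
  by (rule bounded_linear_intro[where K = 1]) (auto simp: vec_eq_iff forall_2)

lemma bounded_linear_complex_of: "bounded_linear complex_of"
  by (rule bounded_linear_intro[where K = 1])
     (auto simp: complex_eq_iff norm_vec_def L2_set_def sum_2 cmod_def)

lemmas continuous_on_plane_of [continuous_intros] =
  bounded_linear.continuous_on[OF bounded_linear_plane_of]
lemmas continuous_on_complex_of [continuous_intros] =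
  bounded_linear.continuous_on[OF bounded_linear_complex_of]

lemma plane_of_0 [simp]: "plane_of 0 = 0"
  by (simp add: vec_eq_iff forall_2)

lemma open_plane_of_image: "open U \<Longrightarrow> open (plane_of ` U)"
proof -
  assume "open U"
  moreover have "plane_of ` U = complex_of -` U"
    by (auto simp: image_iff) (metis plane_of_complex_of)
  ultimately show ?thesis
    by (simp add: open_vimage continuous_on_complex_of continuous_on_id)
qed

section \<open>Layers around an analytic curve\<close>

locale conformal_strip =
  fixes F :: "complex \<Rightarrow> complex" and \<delta> :: real
  assumes \<delta>_pos: "\<delta> > 0"
    and hol: "F holomorphic_on strip \<delta>"
    and per: "\<And>z. z \<in> strip \<delta> \<Longrightarrow> F (z + 1) = F z"
    and inj: "\<And>z w. z \<in> strip \<delta> \<Longrightarrow> w \<in> strip \<delta> \<Longrightarrow> F z = F w \<Longrightarrow> \<exists>n::int. w = z + of_int n"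
begin

definition f :: "complex \<Rightarrow> real^2" where "f z = plane_of (F z)"

lemma strip_mem_iff: "z \<in> strip \<delta> \<longleftrightarrow> Im z \<in> {-\<delta><..<\<delta>}"
  by (auto simp: strip_def)

definition layer :: "real set \<Rightarrow> (real^2) set" where
  "layer I = f ` {z. Im z \<in> I}"

lemma per_int: "z \<in> strip \<delta> \<Longrightarrow> F (z + of_int n) = F z"
  using periodic_strip_int[where F = F and \<delta> = \<delta>, OF per] .

lemma continuous_on_F: "continuous_on (strip \<delta>) F"
  using hol by (rule holomorphic_on_imp_continuous_on)

lemma continuous_on_f: "continuous_on (strip \<delta>) f"
  unfolding f_def by (intro continuous_intros continuous_on_F)

lemma locally_inj:
  assumes "open U" "U \<subseteq> strip \<delta>" "z \<in> U"
  obtains \<rho> where "\<rho> > 0" "ball z \<rho> \<subseteq> U" "inj_on F (ball z \<rho>)"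
proof -
  obtain e where e: "e > 0" "ball z e \<subseteq> U"
    using assms(1,3) open_contains_ball by blast
  define \<rho> where "\<rho> = min e (1/2)"
  have sub: "ball z \<rho> \<subseteq> U" using e by (auto simp: \<rho>_def)
  moreover have "inj_on F (ball z \<rho>)"
  proof (rule inj_onI)
    fix v w assume vw: "v \<in> ball z \<rho>" "w \<in> ball z \<rho>" "F v = F w"
    then obtain n :: int where n: "w = v + of_int n"
      using inj sub assms(2) by blast
    have "dist v w < \<rho> + \<rho>"
      using dist_triangle2[of v w z] vw by (simp add: dist_commute)
    then have "norm (complex_of_int n) < 1"
      unfolding n by (simp add: \<rho>_def dist_norm)
    then have "n = 0" by (simp add: norm_of_int flip: of_int_abs)
    then show "v = w" using n by simp
  qed
  ultimately show thesis using that[of \<rho>] e(1) by (simp add: \<rho>_def)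
qed

lemma deriv_nonzero: "z \<in> strip \<delta> \<Longrightarrow> deriv F z \<noteq> 0"
proof -
  assume z: "z \<in> strip \<delta>"
  obtain \<rho> where \<rho>: "\<rho> > 0" "ball z \<rho> \<subseteq> strip \<delta>" "inj_on F (ball z \<rho>)"
    using locally_inj[OF open_strip order_refl z] by blast
  show ?thesis
    by (rule holomorphic_injective_imp_regular[OF holomorphic_on_subset[OF hol \<rho>(2)] open_ball \<rho>(3)])
       (use \<rho>(1) in auto)
qed

lemma has_deriv: "z \<in> strip \<delta> \<Longrightarrow> (F has_field_derivative deriv F z) (at z)"
  using hol open_strip by (rule holomorphic_derivI)

lemma hol_deriv: "deriv F holomorphic_on strip \<delta>"
  using hol open_strip by (rule holomorphic_deriv)

lemma deriv_per_int: 
  assumes z: "z \<in> strip \<delta>"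
  shows "deriv F (z + of_int n) = deriv F z"
proof -
  have "z + of_int n \<in> strip \<delta>" using z by (simp add: strip_def)
  then have "((\<lambda>z. F (z + of_int n)) has_field_derivative deriv F (z + of_int n)) (at z)"
    using has_deriv DERIV_shift by blast
  then have "(F has_field_derivative deriv F (z + of_int n)) (at z)"
    by (rule has_field_derivative_transform_within_open[OF _ open_strip z]) (rule per_int)
  then show ?thesis using DERIV_imp_deriv by metis
qed

lemma open_f_image:
  assumes U: "open U" "U \<subseteq> strip \<delta>"
  shows "open (f ` U)"
proof -
  have "open (F ` U)"
  proof (rule openI)
    fix w assume "w \<in> F ` U"
    then obtain z where z: "z \<in> U" "w = F z" by blast
    obtain \<rho> where \<rho>: "\<rho> > 0" "ball z \<rho> \<subseteq> U" "inj_on F (ball z \<rho>)"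
      using locally_inj[OF U z(1)] by blast
    have "open (F ` ball z \<rho>)"
      using \<rho>(2,3) U(2) by (intro open_mapping_thm3 holomorphic_on_subset[OF hol]) auto
    moreover have "w \<in> F ` ball z \<rho>" using z \<rho>(1) by auto
    ultimately obtain e where "e > 0" "ball w e \<subseteq> F ` ball z \<rho>"
      using open_contains_ball by blast
    then show "\<exists>e>0. ball w e \<subseteq> F ` U" using \<rho>(2) by blast
  qed
  then have "open (plane_of ` F ` U)" by (rule open_plane_of_image)
  then show ?thesis by (simp add: image_image f_def)
qed

lemma f_eqD:
  assumes "z \<in> strip \<delta>" "w \<in> strip \<delta>" "f z = f w"
  shows "Im z = Im w" "deriv F z = deriv F w"
proof -
  obtain n :: int where "w = z + of_int n"
    using inj assms by (auto simp: f_def)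
  then show "Im z = Im w" "deriv F z = deriv F w"
    using deriv_per_int[OF assms(1)] by auto
qed

lemma f_int: "z \<in> strip \<delta> \<Longrightarrow> f (z + of_int n) = f z"
  by (simp add: f_def per_int)

lemma f_reduce:
  assumes "z \<in> strip \<delta>"
  obtains z' where "f z' = f z" "Im z' = Im z" "0 \<le> Re z'" "Re z' < 1"
proof (rule that[of "z + of_int (- \<lfloor>Re z\<rfloor>)"])
  show "f (z + of_int (- \<lfloor>Re z\<rfloor>)) = f z" by (rule f_int[OF assms])
qed (simp_all, linarith+)

lemma layer_mem: "Im z \<in> I \<Longrightarrow> f z \<in> layer I"
  by (auto simp: layer_def)

lemma f_in_layer_iff:
  assumes "z \<in> strip \<delta>" "I \<subseteq> {-\<delta><..<\<delta>}"
  shows "f z \<in> layer I \<longleftrightarrow> Im z \<in> I"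
proof
  assume "f z \<in> layer I"
  then obtain w where w: "Im w \<in> I" "f w = f z" by (auto simp: layer_def)
  then have "w \<in> strip \<delta>" using assms(2) by (auto simp: strip_mem_iff)
  then show "Im z \<in> I" using f_eqD(1)[of w z] w assms(1) by simp
qed (rule layer_mem)

lemma open_layer:
  assumes "open I" "I \<subseteq> {-\<delta><..<\<delta>}"
  shows "open (layer I)"
proof -
  have "open (Im -` I)" using assms(1) by (simp add: open_vimage continuous_on_Im continuous_on_id)
  moreover have "Im -` I \<subseteq> strip \<delta>" using assms(2) by (auto simp: strip_mem_iff)
  ultimately show ?thesis using open_f_image by (simp add: layer_def vimage_def)
qed

lemma connected_layer:
  assumes "convex I" "I \<subseteq> {-\<delta><..<\<delta>}"
  shows "connected (layer I)"
proof -
  have "convex (Im -` I)" using assms(1)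
    by (simp add: convex_linear_vimage linear_conv_bounded_linear bounded_linear_Im)
  moreover have "Im -` I \<subseteq> strip \<delta>" using assms(2) by (auto simp: strip_mem_iff)
  ultimately have "connected (f ` (Im -` I))"
    by (intro connected_continuous_image convex_connected continuous_on_subset[OF continuous_on_f])
  then show ?thesis by (simp add: layer_def vimage_def)
qed

lemma layer_atLeastAtMost:
  assumes "{a..b} \<subseteq> {-\<delta><..<\<delta>}"
  shows "layer {a..b} = f ` cbox (Complex 0 a) (Complex 1 b)"
proof (intro equalityI subsetI)
  fix w assume "w \<in> layer {a..b}"
  then obtain z where z: "Im z \<in> {a..b}" "w = f z" by (auto simp: layer_def)
  then have "z \<in> strip \<delta>" using assms by (force simp: strip_def)
  then obtain z' where "f z' = f z" "Im z' = Im z" "0 \<le> Re z'" "Re z' < 1"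
    using f_reduce by blast
  then show "w \<in> f ` cbox (Complex 0 a) (Complex 1 b)"
    using z by (intro image_eqI[of _ _ z']) (auto simp: in_cbox_complex_iff)
qed (auto simp: layer_def in_cbox_complex_iff)

lemma compact_layer:
  assumes "{a..b} \<subseteq> {-\<delta><..<\<delta>}"
  shows "compact (layer {a..b})"
  unfolding layer_atLeastAtMost[OF assms]
proof (rule compact_continuous_image)
  have "cbox (Complex 0 a) (Complex 1 b) \<subseteq> strip \<delta>"
  proof
    fix z assume "z \<in> cbox (Complex 0 a) (Complex 1 b)"
    then have "Im z \<in> {a..b}" by (auto simp: in_cbox_complex_iff)
    then show "z \<in> strip \<delta>" using assms by (force simp: strip_def)
  qed
  then show "continuous_on (cbox (Complex 0 a) (Complex 1 b)) f"
    by (rule continuous_on_subset[OF continuous_on_f])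
qed auto

lemma layer_mono: "I \<subseteq> J \<Longrightarrow> layer I \<subseteq> layer J"
  by (auto simp: layer_def)

lemma layer_Un: "layer (I \<union> J) = layer I \<union> layer J"
  by (auto simp: layer_def)

lemma layer_disjoint:
  assumes "I \<inter> J = {}" "I \<subseteq> {-\<delta><..<\<delta>}" "J \<subseteq> {-\<delta><..<\<delta>}"
  shows "layer I \<inter> layer J = {}"
proof -
  have False if "w \<in> layer I" "w \<in> layer J" for w
  proof -
    obtain z where z: "Im z \<in> I" "w = f z" using \<open>w \<in> layer I\<close> by (auto simp: layer_def)
    have "z \<in> strip \<delta>" using z(1) assms(2) by (auto simp: strip_mem_iff)
    then show False using that(2) z f_in_layer_iff[OF _ assms(3)] assms(1) by auto
  qed
  then show ?thesis by blast
qed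

lemma layer_strip: "layer {-\<delta><..<\<delta>} = f ` strip \<delta>"
  by (auto simp: layer_def strip_def abs_less_iff intro!: image_eqI)

lemma continuous_on_push_forward:
  fixes h :: "complex \<Rightarrow> 'a::topological_space"
  assumes h: "continuous_on (strip \<delta>) h" and g: "\<And>z. z \<in> strip \<delta> \<Longrightarrow> g (f z) = h z"
  shows "continuous_on (layer {-\<delta><..<\<delta>}) g"
  unfolding continuous_on_open_vimage[OF open_layer[OF open_greaterThanLessThan order_refl]]
proof (intro allI impI)
  fix B :: "'a set" assume "open B"
  then have "open (h -` B \<inter> strip \<delta>)"
    using h open_strip by (simp add: continuous_on_open_vimage)
  then have "open (f ` (h -` B \<inter> strip \<delta>))" by (rule open_f_image) simp
  moreover have "g -` B \<inter> layer {-\<delta><..<\<delta>} = f ` (h -` B \<inter> strip \<delta>)"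
    unfolding layer_strip using g by auto
  ultimately show "open (g -` B \<inter> layer {-\<delta><..<\<delta>})" by simp
qed

definition z_of :: "real^2 \<Rightarrow> complex" where
  "z_of w = (SOME z. z \<in> strip \<delta> \<and> f z = w)"

lemma z_of_f:
  assumes "z \<in> strip \<delta>"
  shows "Im (z_of (f z)) = Im z" "deriv F (z_of (f z)) = deriv F z"
proof -
  have "z_of (f z) \<in> strip \<delta> \<and> f (z_of (f z)) = f z"
    unfolding z_of_def by (rule someI[of _ z]) (use assms in simp)
  then show "Im (z_of (f z)) = Im z" "deriv F (z_of (f z)) = deriv F z"
    using f_eqD[of "z_of (f z)" z] assms by auto
qed

lemma has_vector_derivative_f:
  assumes "z \<in> strip \<delta>" "(g has_vector_derivative g') (at t within S)" "g t = z"
  shows "((\<lambda>t. f (g t)) has_vector_derivative plane_of (deriv F z * g')) (at t within S)"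
proof -
  have "((F \<circ> g) has_vector_derivative (g' * deriv F z)) (at t within S)"
    using assms by (intro field_vector_diff_chain_within) (auto intro: has_deriv has_field_derivative_at_within)
  then show ?thesis
    unfolding f_def using bounded_linear.has_vector_derivative[OF bounded_linear_plane_of]
    by (simp add: o_def mult.commute)
qed

lemma smooth_horizontal:
  assumes "\<bar>y\<bar> < \<delta>"
  shows "smooth_Jordan_param (\<lambda>t. f (Complex t y))"
proof -
  have s: "Complex t y \<in> strip \<delta>" for t using assms by (simp add: strip_def)
  have vd: "((\<lambda>t. Complex t y) has_vector_derivative 1) (at t)" for t
    by (auto simp: Complex_eq intro!: derivative_eq_intros)
  have der: "((\<lambda>t. plane_of (G (Complex t y))) has_vector_derivative plane_of (deriv G (Complex t y))) (at t)"
    if "G holomorphic_on strip \<delta>" for G t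
  proof -
    have "(G has_field_derivative deriv G (Complex t y)) (at (Complex t y))"
      using that open_strip s by (rule holomorphic_derivI)
    then have "((G \<circ> (\<lambda>t. Complex t y)) has_vector_derivative (1 * deriv G (Complex t y))) (at t)"
      using vd by (intro field_vector_diff_chain_at)
    then show ?thesis
      using bounded_linear.has_vector_derivative[OF bounded_linear_plane_of] by (simp add: o_def)
  qed
  have Ck: "Ck_on k (\<lambda>t. plane_of (G (Complex t y))) UNIV" if "G holomorphic_on strip \<delta>" for G k
    using that
  proof (induction k arbitrary: G)
    case 0
    have "isCont (\<lambda>t. plane_of (G (Complex t y))) t" for t
      using der[OF 0] by (rule has_vector_derivative_continuous)
    then show ?case by (auto intro: continuous_at_imp_continuous_on)
  next
    case (Suc k)
    have "frechet_derivative (\<lambda>t. plane_of (G (Complex t y))) (at t) 1 = plane_of (deriv G (Complex t y))" for t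
      using der[OF Suc.prems, of t] frechet_derivative_at[of "\<lambda>t. plane_of (G (Complex t y))"]
      unfolding has_vector_derivative_def by (metis scaleR_one)
    then show ?case
      using der[OF Suc.prems] Suc.IH[OF holomorphic_deriv[OF Suc.prems open_strip]]
      by (auto intro: differentiableI_vector)
  qed
  have reg: "f (Complex t y) = f (Complex s y) \<longleftrightarrow> (\<exists>n::int. s = t + of_int n)" for t s :: real
  proof
    assume "f (Complex t y) = f (Complex s y)"
    then have "F (Complex t y) = F (Complex s y)" by (simp add: f_def)
    then obtain n :: int where "Complex s y = Complex t y + of_int n"
      using inj s by blast
    then show "\<exists>n::int. s = t + of_int n" by (auto simp: complex_eq_iff)
  next
    assume "\<exists>n::int. s = t + of_int n"
    then obtain n :: int where "Complex s y = Complex t y + of_int n"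
      by (auto simp: complex_eq_iff)
    then show "f (Complex t y) = f (Complex s y)" using f_int[OF s, of t n] by simp
  qed
  have "simple_path (\<lambda>t. f (Complex t y))"
    unfolding simple_path_def path_def loop_free_def
  proof (intro conjI ballI impI)
    show "continuous_on {0..1} (\<lambda>t. f (Complex t y))"
      unfolding f_def using der[OF hol] has_vector_derivative_continuous continuous_at_imp_continuous_on
      by (metis (mono_tags, lifting))
    fix u v :: real assume uv: "u \<in> {0..1}" "v \<in> {0..1}" "f (Complex u y) = f (Complex v y)"
    then obtain n :: int where n: "v = u + of_int n" using reg by blast
    then have "-1 \<le> n" "n \<le> 1" using uv(1,2) by auto
    then consider "n = -1" | "n = 0" | "n = 1" by linarith
    then show "u = v \<or> u = 0 \<and> v = 1 \<or> u = 1 \<and> v = 0"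
      using n uv(1,2) by cases auto
  qed
  moreover have "f (Complex (t + 1) y) = f (Complex t y)" for t
    using reg[of t "t + 1"] by (metis of_int_1)
  moreover have "vector_derivative (\<lambda>t. f (Complex t y)) (at t) \<noteq> 0" for t
    unfolding f_def using vector_derivative_at[OF der[OF hol]] deriv_nonzero[OF s]
    by (metis complex_of_plane_of plane_of_0)
  moreover have "(\<lambda>t. f (Complex t y)) differentiable (at t)" for t
    unfolding f_def using der[OF hol] by (rule differentiableI_vector)
  ultimately show ?thesis
    unfolding smooth_Jordan_param_def regular_Jordan_param_def
    using Ck[OF hol] by (simp add: f_def)
qed

lemma vector_derivative_horizontal:
  assumes "\<bar>y\<bar> < \<delta>"
  shows "((\<lambda>t. f (Complex t y)) has_vector_derivative plane_of (deriv F (Complex t y))) (at t)"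
proof -
  have "((\<lambda>t. Complex t y) has_vector_derivative 1) (at t)"
    by (auto simp: Complex_eq intro!: derivative_eq_intros)
  then show ?thesis
    using has_vector_derivative_f[of "Complex t y" "\<lambda>t. Complex t y" 1 t UNIV] assms
    by (simp add: strip_def)
qed

lemma path_image_horizontal:
  assumes "\<bar>y\<bar> < \<delta>"
  shows "path_image (\<lambda>t. f (Complex t y)) = layer {y}"
proof -
  have "layer {y..y} = f ` cbox (Complex 0 y) (Complex 1 y)"
    using assms by (intro layer_atLeastAtMost) auto
  moreover have "cbox (Complex 0 y) (Complex 1 y) = (\<lambda>t. Complex t y) ` {0..1}"
    by (auto simp: in_cbox_complex_iff complex_eq_iff intro!: image_eqI)
  ultimately show ?thesis by (simp add: path_image_def image_image)
qed

end

lemma subset_inside_of_frontier: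
  fixes R :: "'a::real_normed_vector set"
  assumes "bounded R" "frontier R \<subseteq> C" "R \<inter> C = {}"
  shows "R \<subseteq> inside C"
proof
  fix x assume x: "x \<in> R"
  let ?K = "connected_component_set (- C) x"
  have xC: "x \<notin> C" using x assms(3) by blast
  have "?K \<subseteq> - C" by (rule connected_component_subset)
  then have "?K \<inter> frontier R = {}" using assms(2) by blast
  moreover have "x \<in> ?K" using xC by (simp add: connected_component_refl)
  ultimately have "?K \<subseteq> R"
    using connected_Int_frontier[of ?K R] x by (metis Diff_eq_empty_iff connected_connected_component disjoint_iff)
  then have "bounded ?K" using assms(1) bounded_subset by blast
  then show "x \<in> inside C" using xC by (simp add: inside_def)
qed

context conformal_strip
begin

lemma layer_split: "layer {-\<delta><..<\<delta>} = layer {-\<delta><..<0} \<union> layer {0} \<union> layer {0<..<\<delta>}"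
proof -
  have "{-\<delta><..<\<delta>} = {-\<delta><..<0} \<union> {0} \<union> {0<..<\<delta>}" using \<delta>_pos by auto
  then show ?thesis by (metis layer_Un)
qed

lemma one_side_inside:
  assumes "open \<Omega>" "bounded \<Omega>" "\<Omega> \<noteq> {}" and fr: "frontier \<Omega> = layer {0}"
  shows "layer {0<..<\<delta>} \<inter> closure \<Omega> = {} \<and> layer {-\<delta><..<0} \<subseteq> \<Omega> \<or>
    layer {-\<delta><..<0} \<inter> closure \<Omega> = {} \<and> layer {0<..<\<delta>} \<subseteq> \<Omega>"
proof -
  have clo: "closure \<Omega> = \<Omega> \<union> layer {0}"
    using fr closure_Un_frontier by metis
  have alt: "layer I \<inter> closure \<Omega> = {} \<or> layer I \<subseteq> \<Omega>"
    if I: "convex I" "0 \<notin> I" "I \<subseteq> {-\<delta><..<\<delta>}" for I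
  proof -
    have dis: "layer I \<inter> layer {0} = {}"
      using I \<delta>_pos by (intro layer_disjoint) auto
    have "connected (layer I)" using I by (intro connected_layer)
    then have "layer I \<inter> \<Omega> = {} \<or> layer I \<subseteq> \<Omega>"
      using connected_Int_frontier[of "layer I" \<Omega>] dis fr by blast
    then show ?thesis using dis clo by blast
  qed
  have V: "open (layer {-\<delta><..<\<delta>})" by (rule open_layer) auto
  have f0: "f 0 \<in> layer {0}" by (rule layer_mem) simp
  have not_out: "\<not> (layer {0<..<\<delta>} \<inter> closure \<Omega> = {} \<and> layer {-\<delta><..<0} \<inter> closure \<Omega> = {})"
  proof
    assume "layer {0<..<\<delta>} \<inter> closure \<Omega> = {} \<and> layer {-\<delta><..<0} \<inter> closure \<Omega> = {}"
    then have "layer {-\<delta><..<\<delta>} \<inter> \<Omega> \<subseteq> layer {0} \<inter> \<Omega>"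
      unfolding layer_split using closure_subset by blast
    also have "\<dots> = {}" using fr \<open>open \<Omega>\<close> by (auto simp: frontier_def interior_open simp flip: fr)
    finally have "layer {-\<delta><..<\<delta>} \<inter> \<Omega> = {}" by blast
    moreover have "f 0 \<in> layer {-\<delta><..<\<delta>}" "f 0 \<in> closure \<Omega>"
      using f0 clo by (auto simp: layer_split)
    ultimately show False using V closure_iff_nhds_not_empty
      by (metis inf_commute order_refl)
  qed
  have not_in: "\<not> (layer {0<..<\<delta>} \<subseteq> \<Omega> \<and> layer {-\<delta><..<0} \<subseteq> \<Omega>)"
  proof
    assume "layer {0<..<\<delta>} \<subseteq> \<Omega> \<and> layer {-\<delta><..<0} \<subseteq> \<Omega>"
    then have "closure \<Omega> = \<Omega> \<union> layer {-\<delta><..<\<delta>}"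
      unfolding clo layer_split by blast
    then have "open (closure \<Omega>)" using V \<open>open \<Omega>\<close> by auto
    then have "closure \<Omega> = {} \<or> closure \<Omega> = UNIV"
      using clopen closed_closure by blast
    moreover have "bounded (closure \<Omega>)" using \<open>bounded \<Omega>\<close> by (rule bounded_closure)
    ultimately show False
      using \<open>\<Omega> \<noteq> {}\<close> not_bounded_UNIV[where 'a = "real^2"] by auto
  qed
  show ?thesis
  proof -
    have "{0<..<\<delta>} \<subseteq> {-\<delta><..<\<delta>}" "{-\<delta><..<0} \<subseteq> {-\<delta><..<\<delta>}" using \<delta>_pos by auto
    then have "layer {0<..<\<delta>} \<inter> closure \<Omega> = {} \<or> layer {0<..<\<delta>} \<subseteq> \<Omega>"
      "layer {-\<delta><..<0} \<inter> closure \<Omega> = {} \<or> layer {-\<delta><..<0} \<subseteq> \<Omega>"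
      using alt[of "{0<..<\<delta>}"] alt[of "{-\<delta><..<0}"] by simp_all
    then show ?thesis using not_in not_out by argo
  qed
qed

lemma reflected: "conformal_strip (\<lambda>z. F (- z)) \<delta>"
proof
  show "(\<lambda>z. F (- z)) holomorphic_on strip \<delta>"
  proof -
    have "(F \<circ> uminus) holomorphic_on strip \<delta>"
      by (rule holomorphic_on_compose_gen[OF _ hol]) (auto simp: strip_def intro!: holomorphic_intros)
    then show ?thesis by (simp add: o_def)
  qed
  fix z assume z: "z \<in> strip \<delta>"
  then have "- z \<in> strip \<delta>" by (simp add: strip_def)
  then show "F (- (z + 1)) = F (- z)" using per_int[of "- z" "-1"] by simp
next
  fix z w assume "z \<in> strip \<delta>" "w \<in> strip \<delta>" "F (- z) = F (- w)"
  then obtain n :: int where "- w = - z + of_int n"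
    using inj[of "- z" "- w"] by (auto simp: strip_def)
  then have "w = z + of_int (- n)" by (simp add: algebra_simps minus_equation_iff)
  then show "\<exists>n::int. w = z + of_int n" by blast
qed (rule \<delta>_pos)

lemma normal_orthogonal:
  assumes "open \<Omega>" and fr: "frontier \<Omega> = layer {0}" and n: "outward_unit_normal \<Omega> (f (of_real t)) n"
  shows "plane_of (deriv F (of_real t)) \<bullet> n = 0"
proof -
  let ?g = "\<lambda>s. f (Complex s 0)"
  define v where "v = plane_of (deriv F (of_real t))"
  have t0: "Complex t 0 = of_real t" by (simp add: complex_eq_iff)
  have v0: "v \<noteq> 0"
    using deriv_nonzero[of "of_real t"] \<delta>_pos unfolding v_def
    by (metis strip_iff Im_complex_of_real abs_zero plane_of_0 plane_of_eq_iff)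
  have der: "(?g has_vector_derivative v) (at t)"
    using vector_derivative_horizontal[of 0 t] \<delta>_pos by (simp add: v_def t0)
  have "((\<lambda>s. (?g s - ?g t - (s - t) *\<^sub>R v) /\<^sub>R \<bar>s - t\<bar>) \<longlongrightarrow> 0) (at t)"
    using der unfolding has_vector_derivative_def has_derivative_at_within by simp
  then have "((\<lambda>s. norm ((?g s - ?g t - (s - t) *\<^sub>R v) /\<^sub>R \<bar>s - t\<bar>)) \<longlongrightarrow> 0) (at t)"
    by (rule tendsto_norm_zero)
  moreover have "\<forall>\<^sub>F s in at t. norm ((?g s - ?g t - (s - t) *\<^sub>R v) /\<^sub>R \<bar>s - t\<bar>) =
      norm ((?g s - ?g t) /\<^sub>R (s - t) - v)"
  proof -
    have "norm ((?g s - ?g t - (s - t) *\<^sub>R v) /\<^sub>R \<bar>s - t\<bar>) =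
      norm ((?g s - ?g t) /\<^sub>R (s - t) - v)" if "s \<noteq> t" for s
    proof -
      from that have "(?g s - ?g t) /\<^sub>R (s - t) - v = (?g s - ?g t - (s - t) *\<^sub>R v) /\<^sub>R (s - t)"
        by (simp add: scaleR_diff_right)
      then show ?thesis by (simp add: divide_inverse)
    qed
    then show ?thesis by (simp add: eventually_at_filter)
  qed
  ultimately have "((\<lambda>s. norm ((?g s - ?g t) /\<^sub>R (s - t) - v)) \<longlongrightarrow> 0) (at t)"
    by (rule Lim_transform_eventually)
  then have lim: "((\<lambda>s. (?g s - ?g t) /\<^sub>R (s - t)) \<longlongrightarrow> v) (at t)"
    by (rule LIM_zero_cancel[OF tendsto_norm_zero_cancel])
  have cont: "(?g \<longlongrightarrow> ?g t) (at t)"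
    using has_vector_derivative_continuous[OF der] by (simp add: isCont_def)
  have ne: "\<forall>\<^sub>F s in at t. ?g s \<noteq> ?g t"
  proof -
    have "\<forall>\<^sub>F s in at t. (?g s - ?g t) /\<^sub>R (s - t) \<noteq> 0"
      using lim v0 by (rule tendsto_imp_eventually_ne)
    then show ?thesis by eventually_elim auto
  qed
  have at: "filterlim ?g (at (?g t)) (at t)"
    using cont ne by (simp add: filterlim_at)
  have small: "\<bar>v \<bullet> n\<bar> \<le> \<epsilon> * norm v" if \<epsilon>: "\<epsilon> > 0" for \<epsilon>
  proof -
    have "\<forall>\<^sub>F y in at (?g t).
        ((y - ?g t) \<bullet> n < - \<epsilon> * norm (y - ?g t) \<longrightarrow> y \<in> \<Omega>) \<and>
        ((y - ?g t) \<bullet> n > \<epsilon> * norm (y - ?g t) \<longrightarrow> y \<notin> closure \<Omega>)"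
      using n \<epsilon> unfolding outward_unit_normal_def t0 by blast
    then have "\<forall>\<^sub>F s in at t.
        ((?g s - ?g t) \<bullet> n < - \<epsilon> * norm (?g s - ?g t) \<longrightarrow> ?g s \<in> \<Omega>) \<and>
        ((?g s - ?g t) \<bullet> n > \<epsilon> * norm (?g s - ?g t) \<longrightarrow> ?g s \<notin> closure \<Omega>)"
      using at by (rule eventually_compose_filterlim)
    then have le: "\<forall>\<^sub>F s in at t. \<bar>((?g s - ?g t) /\<^sub>R (s - t)) \<bullet> n\<bar> \<le> \<epsilon> * norm ((?g s - ?g t) /\<^sub>R (s - t))"
    proof eventually_elim
      case (elim s)
      have "?g s \<in> layer {0}" by (rule layer_mem) simp
      then have "?g s \<in> frontier \<Omega>" using fr by simp
      then have "?g s \<notin> \<Omega>" "?g s \<in> closure \<Omega>"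
        using \<open>open \<Omega>\<close> by (auto simp: frontier_def interior_open)
      with elim have "\<bar>(?g s - ?g t) \<bullet> n\<bar> \<le> \<epsilon> * norm (?g s - ?g t)" by auto
      then have "\<bar>inverse (s - t)\<bar> * \<bar>(?g s - ?g t) \<bullet> n\<bar> \<le> \<bar>inverse (s - t)\<bar> * (\<epsilon> * norm (?g s - ?g t))"
        by (intro mult_left_mono) auto
      then show ?case by (simp add: abs_mult mult_ac)
    qed
    show ?thesis
      by (intro tendsto_le[OF _ _ _ le] tendsto_intros lim) simp
  qed
  have "\<bar>v \<bullet> n\<bar> \<le> 0 + e" if "e > 0" for e
    using small[of "e / norm v"] that v0 by simp
  then have "\<bar>v \<bullet> n\<bar> \<le> 0" by (rule field_le_epsilon)
  then show ?thesis by (simp add: v_def)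
qed

end

locale current_sheet = conformal_strip +
  fixes \<Omega> :: "(real^2) set" and \<epsilon> c :: real
  assumes open_\<Omega>: "open \<Omega>" and bounded_\<Omega>: "bounded \<Omega>" and frontier_\<Omega>: "frontier \<Omega> = layer {0}"
    and outer: "layer {0<..<\<delta>} \<inter> closure \<Omega> = {}" and inner: "layer {-\<delta><..<0} \<subseteq> \<Omega>"
    and \<epsilon>: "0 < \<epsilon>" "\<epsilon> < \<delta>" and c_pos: "0 < c"
begin

definition \<Gamma> :: "real \<Rightarrow> real^2" where "\<Gamma> t = f (Complex t \<epsilon>)"

definition ring_field :: "real^2 \<Rightarrow> real^2" where
  "ring_field w = plane_of (- of_real c / cnj (deriv F (z_of w)))"

definition ring_potential :: "real^2 \<Rightarrow> real" where
  "ring_potential w = c * (Im (z_of w) - \<epsilon>)"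

definition ext_field :: "real^2 \<Rightarrow> real^2" where
  "ext_field w = (if w \<in> layer {0..<\<epsilon>} then ring_field w else 0)"

text \<open>The free constant is chosen so that the potential vanishes outside the sheet, not on the
  boundary of \<open>\<Omega>\<close>.\<close>

definition ext_potential :: "real^2 \<Rightarrow> real" where
  "ext_potential w = (if w \<in> layer {0<..<\<epsilon>} then ring_potential w else 0)"

definition sheet_current :: "real^2 \<Rightarrow> real" where
  "sheet_current w = (if w \<in> layer {\<epsilon>} then - norm (ring_field w) else 0)"

lemma \<Gamma>_eq: "\<Gamma> = (\<lambda>t. f (Complex t \<epsilon>))"
  by (simp add: \<Gamma>_def fun_eq_iff)

lemma path_image_\<Gamma>: "path_image \<Gamma> = layer {\<epsilon>}"
  unfolding \<Gamma>_eq using \<epsilon> by (intro path_image_horizontal) auto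

lemma smooth_\<Gamma>: "smooth_Jordan_param \<Gamma>"
  unfolding \<Gamma>_eq using \<epsilon> by (intro smooth_horizontal) auto

lemma closure_\<Omega>: "closure \<Omega> = \<Omega> \<union> layer {0}"
  using frontier_\<Omega> closure_Un_frontier by metis

lemma frontier_disjoint: "\<Omega> \<inter> layer {0} = {}"
  using frontier_\<Omega> open_\<Omega> by (auto simp: frontier_def interior_open simp flip: frontier_\<Omega>)

lemma layer_outside: "I \<subseteq> {0<..<\<delta>} \<Longrightarrow> layer I \<inter> closure \<Omega> = {}"
  using outer layer_mono by blast

lemma layer_nonneg_disjoint: "I \<subseteq> {0..<\<delta>} \<Longrightarrow> layer I \<inter> \<Omega> = {}"
proof -
  assume "I \<subseteq> {0..<\<delta>}"
  then have "layer I \<subseteq> layer ({0<..<\<delta>} \<union> {0})" by (intro layer_mono) auto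
  then show ?thesis using outer frontier_disjoint closure_subset unfolding layer_Un by blast
qed

lemma open_filled: "open (\<Omega> \<union> layer {0..<\<epsilon>})"
proof -
  have "{-\<delta><..<\<epsilon>} = {-\<delta><..<0} \<union> {0..<\<epsilon>}" using \<epsilon> by auto
  then have "\<Omega> \<union> layer {0..<\<epsilon>} = \<Omega> \<union> layer {-\<delta><..<\<epsilon>}"
    using inner by (auto simp: layer_Un)
  moreover have "open (layer {-\<delta><..<\<epsilon>})" using \<epsilon> by (intro open_layer) auto
  ultimately show ?thesis using open_\<Omega> by (metis open_Un)
qed

lemma compact_filled: "compact (\<Omega> \<union> layer {0..\<epsilon>})"
proof -
  have "\<Omega> \<union> layer {0..\<epsilon>} = closure \<Omega> \<union> layer {0..\<epsilon>}"
    using layer_mono[of "{0}" "{0..\<epsilon>}"] \<epsilon> by (auto simp: closure_\<Omega>)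
  moreover have "compact (layer {0..\<epsilon>})" using \<epsilon> by (intro compact_layer) auto
  moreover have "compact (closure \<Omega>)" using bounded_\<Omega> by (simp add: compact_closure)
  ultimately show ?thesis by (simp add: compact_Un)
qed

lemma \<Omega>_inside: "\<Omega> \<subseteq> inside (path_image \<Gamma>)"
proof -
  let ?R = "\<Omega> \<union> layer {0..<\<epsilon>}"
  have le: "layer {0..\<epsilon>} = layer {0..<\<epsilon>} \<union> layer {\<epsilon>}"
    using \<epsilon> by (subst layer_Un[symmetric]) (rule arg_cong[where f = layer], auto)
  have cl: "closure ?R \<subseteq> \<Omega> \<union> layer {0..\<epsilon>}"
    by (rule closure_minimal) (use compact_filled compact_imp_closed le in auto)
  have "?R \<subseteq> inside (layer {\<epsilon>})"
  proof (rule subset_inside_of_frontier)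
    show "bounded ?R"
      using compact_imp_bounded[OF compact_filled] by (rule bounded_subset) (use le in auto)
    show "frontier ?R \<subseteq> layer {\<epsilon>}"
      using cl open_filled le by (auto simp: frontier_def interior_open)
    have "layer {0..<\<epsilon>} \<inter> layer {\<epsilon>} = {}" using \<epsilon> by (intro layer_disjoint) auto
    moreover have "layer {\<epsilon>} \<inter> \<Omega> = {}" using \<epsilon> by (intro layer_nonneg_disjoint) auto
    ultimately show "?R \<inter> layer {\<epsilon>} = {}" by blast
  qed
  then show ?thesis by (simp add: path_image_\<Gamma>)
qed

lemma \<Gamma>_outside: "path_image \<Gamma> \<subseteq> - closure \<Omega>"
  using layer_outside[of "{\<epsilon>}"] \<epsilon> by (auto simp: path_image_\<Gamma>)

lemma ring_field_f: "z \<in> strip \<delta> \<Longrightarrow> ring_field (f z) = plane_of (- of_real c / cnj (deriv F z))"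
  by (simp add: ring_field_def z_of_f)

lemma ring_potential_f: "z \<in> strip \<delta> \<Longrightarrow> ring_potential (f z) = c * (Im z - \<epsilon>)"
  by (simp add: ring_potential_def z_of_f)

lemma continuous_on_ring_field: "continuous_on (layer {-\<delta><..<\<delta>}) ring_field"
  by (rule continuous_on_push_forward[where g = ring_field, OF _ ring_field_f])
     (auto intro!: continuous_intros holomorphic_on_imp_continuous_on[OF hol_deriv] simp: deriv_nonzero)

lemma continuous_on_ring_potential: "continuous_on (layer {-\<delta><..<\<delta>}) ring_potential"
  by (rule continuous_on_push_forward[where g = ring_potential, OF _ ring_potential_f]) (auto intro!: continuous_intros)

lemma continuous_on_ext_field: "continuous_on (- \<Omega> - path_image \<Gamma>) ext_field"
proof -
  let ?S = "- \<Omega> - path_image \<Gamma>"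
  let ?U = "layer {-\<delta><..<\<epsilon>}" and ?V = "- (\<Omega> \<union> layer {0..\<epsilon>})"
  have le: "layer {0..\<epsilon>} = layer {0..<\<epsilon>} \<union> layer {\<epsilon>}"
    using \<epsilon> by (subst layer_Un[symmetric]) (rule arg_cong[where f = layer], auto)
  have U: "open ?U" using \<epsilon> by (intro open_layer) auto
  have V: "open ?V" using compact_imp_closed[OF compact_filled] by (rule open_Compl)
  have Us: "?U = layer {-\<delta><..<0} \<union> layer {0..<\<epsilon>}"
    using \<epsilon> by (subst layer_Un[symmetric]) (rule arg_cong[where f = layer], auto)
  have S: "?S = (?S \<inter> ?U) \<union> (?S \<inter> ?V)"
    by (auto simp: path_image_\<Gamma> le Us)
  have SU: "?S \<inter> ?U \<subseteq> layer {0..<\<epsilon>}" using inner by (auto simp: Us)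
  have "continuous_on (layer {0..<\<epsilon>}) ring_field"
    using continuous_on_ring_field by (rule continuous_on_subset) (use \<epsilon> in \<open>auto intro!: layer_mono\<close>)
  then have "continuous_on (?S \<inter> ?U) ring_field" using SU by (rule continuous_on_subset)
  then have cU: "continuous_on (?S \<inter> ?U) ext_field"
    by (rule continuous_on_eq) (use SU in \<open>auto simp: ext_field_def\<close>)
  have cV: "continuous_on (?S \<inter> ?V) ext_field"
    by (rule continuous_on_eq[of _ "\<lambda>_. 0"]) (auto simp: ext_field_def le)
  have "continuous_on ((?S \<inter> ?U) \<union> (?S \<inter> ?V)) ext_field"
    using openin_open_Int[OF U, of ?S] openin_open_Int[OF V, of ?S] cU cV
    by (intro continuous_on_Un_local_open) (simp_all only: S[symmetric])
  then show ?thesis using S by simp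
qed

lemma ext_field_at_infinity: "(ext_field \<longlongrightarrow> 0) at_infinity"
proof -
  obtain b where b: "\<And>w. w \<in> \<Omega> \<union> layer {0..\<epsilon>} \<Longrightarrow> norm w \<le> b"
    using compact_imp_bounded[OF compact_filled] unfolding bounded_iff by blast
  have "ext_field w = 0" if "b + 1 \<le> norm w" for w
  proof -
    have "w \<notin> layer {0..\<epsilon>}" using b[of w] that by auto
    moreover have "layer {0..<\<epsilon>} \<subseteq> layer {0..\<epsilon>}" by (rule layer_mono) auto
    ultimately have "w \<notin> layer {0..<\<epsilon>}" by blast
    then show ?thesis by (simp add: ext_field_def)
  qed
  then have "\<forall>\<^sub>F w in at_infinity. ext_field w = 0"
    unfolding eventually_at_infinity by blast
  then show ?thesis by (rule tendsto_eventually)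
qed

lemma norm_ring_field: "z \<in> strip \<delta> \<Longrightarrow> norm (ring_field (f z)) = \<bar>c\<bar> / cmod (deriv F z)"
  by (simp add: ring_field_f norm_divide)

lemma ext_field_frontier: "ext_field (f (of_real t)) = plane_of (- of_real c / cnj (deriv F (of_real t)))"
proof -
  have "complex_of_real t \<in> strip \<delta>" using \<delta>_pos by (simp add: strip_def)
  moreover have "f (of_real t) \<in> layer {0..<\<epsilon>}" using \<epsilon> by (intro layer_mem) simp
  ultimately show ?thesis by (simp add: ext_field_def ring_field_f)
qed

lemma ext_field_tangential:
  assumes "outward_unit_normal \<Omega> (f (of_real t)) n"
  shows "ext_field (f (of_real t)) \<bullet> n = 0"
proof -
  let ?d = "deriv F (of_real t)"
  have "- of_real c / cnj ?d = of_real (- c / (cmod ?d)\<^sup>2) * ?d"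
  proof (cases "?d = 0")
    case False
    then show ?thesis
      by (simp add: field_simps complex_norm_square del: of_real_power)
  qed simp
  then have "ext_field (f (of_real t)) = (- c / (cmod ?d)\<^sup>2) *\<^sub>R plane_of ?d"
    unfolding ext_field_frontier
    using linear_scale[OF bounded_linear.linear[OF bounded_linear_plane_of]] scaleR_conv_of_real by metis
  then show ?thesis
    using normal_orthogonal[OF open_\<Omega> frontier_\<Omega> assms] by simp
qed

end

section \<open>Integration over a rectangle\<close>

lemma integral_cbox_plane:
  fixes h :: "real^2 \<Rightarrow> 'b::euclidean_space"
  assumes "continuous_on (cbox (vector [a, c]) (vector [b, d])) h"
  shows "integral (cbox (vector [a, c]) (vector [b, d])) h =
    integral {a..b} (\<lambda>x. integral {c..d} (\<lambda>y. h (vector [x, y])))"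
proof -
  let ?g = "\<lambda>(x::real, y::real). vector [x, y] :: real^2" and ?h = "\<lambda>v::real^2. (v $ 1, v $ 2)"
  have gbox: "?g ` cbox u v = cbox (?g u) (?g v)" for u v
  proof -
    obtain u1 u2 v1 v2 where uv: "u = (u1, u2)" "v = (v1, v2)" by (cases u, cases v)
    have "w \<in> ?g ` (cbox u1 v1 \<times> cbox u2 v2)" if "w \<in> cbox (?g u) (?g v)" for w
      using that uv
      by (intro image_eqI[of _ _ "(w $ 1, w $ 2)"]) (auto simp: mem_box_cart forall_2 vec_eq_iff)
    then show ?thesis
      by (auto simp: uv cbox_Pair_eq mem_box_cart forall_2)
  qed
  have hbox: "?h ` cbox u v = cbox (?h u) (?h v)" for u v
  proof -
    have "(x, y) \<in> ?h ` cbox u v" if "(x, y) \<in> cbox (?h u) (?h v)" for x y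
      using that by (intro image_eqI[of _ _ "vector [x, y]"]) (auto simp: mem_box_cart forall_2 cbox_Pair_eq)
    then show ?thesis
      by (auto simp: cbox_Pair_eq mem_box_cart forall_2)
  qed
  have cont_g: "continuous (at x) ?g" for x
  proof -
    have "bounded_linear ?g"
      by (rule bounded_linear_intro[where K = 1])
         (auto simp: vec_eq_iff forall_2 norm_vec_def L2_set_def sum_2 norm_prod_def)
    then show ?thesis by (rule linear_continuous_at)
  qed
  have content: "measure lborel (?g ` cbox u v) = 1 * measure lborel (cbox u v)" for u v
  proof -
    obtain u1 u2 v1 v2 where uv: "u = (u1, u2)" "v = (v1, v2)" by (cases u, cases v)
    show ?thesis
    proof (cases "u1 \<le> v1 \<and> u2 \<le> v2")
      case True
      then have "measure lborel (cbox (vector [u1, u2] :: real^2) (vector [v1, v2])) = (v1 - u1) * (v2 - u2)"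
        by (subst content_cbox_cart) (simp_all add: interval_ne_empty_cart UNIV_2 forall_2)
      moreover have "measure lborel (cbox (u1, u2) (v1, v2)) = (v1 - u1) * (v2 - u2)"
        using True by (simp add: content_Pair)
      ultimately show ?thesis unfolding gbox uv by simp
    next
      case False
      then have "cbox (u1, u2) (v1, v2) = {}" by (auto simp: cbox_Pair_eq)
      then show ?thesis by (simp add: uv)
    qed
  qed
  have "(h has_integral integral (cbox (vector [a, c]) (vector [b, d])) h)
      (cbox (vector [a, c]) (vector [b, d]))"
    using assms by (intro integrable_integral integrable_continuous)
  then have "((\<lambda>x. h (?g x)) has_integral (1 / 1) *\<^sub>R integral (cbox (vector [a, c]) (vector [b, d])) h)
      (?h ` cbox (vector [a, c]) (vector [b, d]))"
    by (intro has_integral_twiddle[where g = ?g and h = ?h])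
       (use gbox hbox cont_g content in \<open>auto simp: vec_eq_iff forall_2\<close>)
  then have int: "((\<lambda>x. h (?g x)) has_integral integral (cbox (vector [a, c]) (vector [b, d])) h)
      (cbox (a, c) (b, d))"
    by (simp add: hbox)
  have "continuous_on (cbox (a, c) (b, d)) (\<lambda>x. h (?g x))"
    by (rule continuous_on_compose2[OF assms])
       (use gbox[of "(a, c)" "(b, d)"] in \<open>auto intro: continuous_at_imp_continuous_on cont_g\<close>)
  from integral_prod_continuous[OF this] int show ?thesis
    by (simp add: integral_unique)
qed

lemma strip_divergence:
  fixes P Q PX QY :: "complex \<Rightarrow> 'b::euclidean_space"
  assumes \<epsilon>: "0 < \<epsilon>"
    and cont: "continuous_on (cbox 0 (Complex 1 \<epsilon>)) PX" "continuous_on (cbox 0 (Complex 1 \<epsilon>)) QY"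
    and dP: "\<And>x y. 0 \<le> y \<Longrightarrow> y \<le> \<epsilon> \<Longrightarrow>
      ((\<lambda>x. P (Complex x y)) has_vector_derivative PX (Complex x y)) (at x)"
    and dQ: "\<And>x y. 0 \<le> y \<Longrightarrow> y \<le> \<epsilon> \<Longrightarrow>
      ((\<lambda>y. Q (Complex x y)) has_vector_derivative QY (Complex x y)) (at y)"
    and per: "\<And>y. 0 \<le> y \<Longrightarrow> y \<le> \<epsilon> \<Longrightarrow> P (Complex 1 y) = P (Complex 0 y)"
  shows "integral (cbox (vector [0, 0]) (vector [1, \<epsilon>])) (\<lambda>v. PX (complex_of v) + QY (complex_of v)) =
    integral {0..1} (\<lambda>x. Q (Complex x \<epsilon>) - Q (Complex x 0))"
proof -
  let ?R = "cbox (vector [0, 0]) (vector [1, \<epsilon>]) :: (real^2) set"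
  have sub: "complex_of ` ?R \<subseteq> cbox 0 (Complex 1 \<epsilon>)"
    by (auto simp: in_cbox_complex_iff mem_box_cart forall_2)
  have cR: "continuous_on ?R (\<lambda>v. K (complex_of v))" if "continuous_on (cbox 0 (Complex 1 \<epsilon>)) K"
    for K :: "complex \<Rightarrow> 'b"
    by (rule continuous_on_compose2[OF that _ sub]) (intro continuous_intros)
  have cV: "complex_of (vector [x, y]) = Complex x y" for x y
    by (simp add: complex_eq_iff)
  have "integral ?R (\<lambda>v. PX (complex_of v)) = integral {0..1} (\<lambda>x. integral {0..\<epsilon>} (\<lambda>y. PX (Complex x y)))"
    using integral_cbox_plane[OF cR[OF cont(1)]] by (simp add: cV)
  also have "\<dots> = integral {0..\<epsilon>} (\<lambda>y. integral {0..1} (\<lambda>x. PX (Complex x y)))"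
  proof -
    have "continuous_on (cbox (0, 0) (1, \<epsilon>)) (\<lambda>z. PX (Complex (fst z) (snd z)))"
    proof (rule continuous_on_compose2[OF cont(1)])
      show "continuous_on (cbox (0, 0) (1, \<epsilon>)) (\<lambda>z. Complex (fst z) (snd z))"
        unfolding Complex_eq by (intro continuous_intros)
    qed (auto simp: in_cbox_complex_iff cbox_Pair_eq)
    then have "continuous_on (cbox (0, 0) (1, \<epsilon>)) (\<lambda>(x, y). PX (Complex x y))"
      by (simp add: case_prod_beta)
    from integral_swap_continuous[OF this] show ?thesis by simp
  qed
  also have "\<dots> = integral {0..\<epsilon>} (\<lambda>y. 0)"
  proof (rule Henstock_Kurzweil_Integration.integral_cong)
    fix y assume "y \<in> {0..\<epsilon>}"
    then have "((\<lambda>x. PX (Complex x y)) has_integral (P (Complex 1 y) - P (Complex 0 y))) {0..1}"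
      using dP by (intro fundamental_theorem_of_calculus) (auto intro: has_vector_derivative_at_within)
    then show "integral {0..1} (\<lambda>x. PX (Complex x y)) = 0"
      using per \<open>y \<in> {0..\<epsilon>}\<close> by (simp add: integral_unique)
  qed
  finally have 1: "integral ?R (\<lambda>v. PX (complex_of v)) = 0" by simp
  have "integral ?R (\<lambda>v. QY (complex_of v)) = integral {0..1} (\<lambda>x. integral {0..\<epsilon>} (\<lambda>y. QY (Complex x y)))"
    using integral_cbox_plane[OF cR[OF cont(2)]] by (simp add: cV)
  also have "\<dots> = integral {0..1} (\<lambda>x. Q (Complex x \<epsilon>) - Q (Complex x 0))"
  proof (rule Henstock_Kurzweil_Integration.integral_cong)
    fix x :: real
    have "((\<lambda>y. QY (Complex x y)) has_integral (Q (Complex x \<epsilon>) - Q (Complex x 0))) {0..\<epsilon>}"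
      using dQ \<epsilon> by (intro fundamental_theorem_of_calculus) (auto intro: has_vector_derivative_at_within)
    then show "integral {0..\<epsilon>} (\<lambda>y. QY (Complex x y)) = Q (Complex x \<epsilon>) - Q (Complex x 0)"
      by (rule integral_unique)
  qed
  finally have 2: "integral ?R (\<lambda>v. QY (complex_of v)) = \<dots>" .
  have "integral ?R (\<lambda>v. PX (complex_of v) + QY (complex_of v)) =
      integral ?R (\<lambda>v. PX (complex_of v)) + integral ?R (\<lambda>v. QY (complex_of v))"
    by (intro integral_add integrable_continuous cR cont)
  with 1 2 show ?thesis by simp
qed

section \<open>Partial derivatives\<close>

lemma chain_partial:
  fixes \<phi> :: "real^2 \<Rightarrow> 'b::real_normed_vector"
  assumes "\<phi> differentiable (at (g t))" "(g has_vector_derivative g') (at t)"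
  shows "((\<lambda>t. \<phi> (g t)) has_vector_derivative
     (g' $ 1) *\<^sub>R partial 1 \<phi> (g t) + (g' $ 2) *\<^sub>R partial 2 \<phi> (g t)) (at t)"
proof -
  let ?D = "frechet_derivative \<phi> (at (g t))"
  have D: "(\<phi> has_derivative ?D) (at (g t))"
    using assms(1) by (simp add: frechet_derivative_works)
  then have "linear ?D" by (rule has_derivative_linear)
  have "g' = (g' $ 1) *\<^sub>R axis 1 1 + (g' $ 2) *\<^sub>R axis 2 1"
    by (simp add: vec_eq_iff forall_2 axis_def)
  then have "?D g' = (g' $ 1) *\<^sub>R partial 1 \<phi> (g t) + (g' $ 2) *\<^sub>R partial 2 \<phi> (g t)"
    using linear_add[OF \<open>linear ?D\<close>] linear_scale[OF \<open>linear ?D\<close>] unfolding partial_def by metis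
  moreover have "((\<phi> \<circ> g) has_vector_derivative ?D g') (at t)"
    by (rule vector_derivative_diff_chain_within[OF assms(2) has_derivative_at_withinI[OF D]])
  ultimately show ?thesis by (simp add: o_def)
qed

lemma Ck_on_Suc_partial:
  assumes "Ck_on (Suc k) \<phi> (UNIV :: (real^2) set)"
  shows "\<phi> differentiable (at x)" "Ck_on k (partial i \<phi>) UNIV"
proof -
  have "axis i 1 \<in> (Basis :: (real^2) set)" by (simp add: axis_in_Basis_iff)
  then show "Ck_on k (partial i \<phi>) UNIV"
    using assms unfolding partial_def[abs_def] by simp
qed (use assms in simp)

lemma test_function_smooth:
  assumes "test_function V \<phi>"
  shows "\<phi> differentiable (at x)" "partial i \<phi> differentiable (at x)"
    "continuous_on S \<phi>" "continuous_on S (partial i \<phi>)" "continuous_on S (partial j (partial i \<phi>))"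
proof -
  have 3: "Ck_on (Suc (Suc (Suc 0))) \<phi> UNIV" using assms by (simp only: test_function_def)
  note 2 = Ck_on_Suc_partial(2)[OF 3]
  note 1 = Ck_on_Suc_partial(2)[OF 2]
  show "\<phi> differentiable (at x)" "partial i \<phi> differentiable (at x)"
    using Ck_on_Suc_partial(1)[OF 3] Ck_on_Suc_partial(1)[OF 2] by blast+
  have c: "continuous_on S g" if "\<And>x. g differentiable (at x)" for g :: "real^2 \<Rightarrow> real"
    using that by (meson continuous_at_imp_continuous_on differentiable_imp_continuous_within)
  show "continuous_on S \<phi>" "continuous_on S (partial i \<phi>)" "continuous_on S (partial j (partial i \<phi>))"
    by (intro c Ck_on_Suc_partial(1)[OF 3] Ck_on_Suc_partial(1)[OF 2] Ck_on_Suc_partial(1)[OF 1])+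
qed

lemma test_function_vanish:
  assumes "test_function V \<phi>" "x \<notin> V"
  shows "\<phi> x = 0" "partial i \<phi> x = 0"
proof -
  let ?U = "- closure {x. \<phi> x \<noteq> 0}"
  have x: "x \<in> ?U" using assms unfolding test_function_def by blast
  have U0: "\<phi> y = 0" if "y \<in> ?U" for y using that closure_subset[of "{x. \<phi> x \<noteq> 0}"] by blast
  show "\<phi> x = 0" using U0 x by blast
  have "(\<phi> has_derivative (\<lambda>_. 0)) (at x)"
  proof (rule has_derivative_transform_within_open)
    show "((\<lambda>_. 0 :: real) has_derivative (\<lambda>_. 0)) (at x)" by (rule has_derivative_const)
    show "open ?U" by (rule open_Compl) (rule closed_closure)
    show "x \<in> ?U" by (rule x)
    show "0 = \<phi> y" if "y \<in> ?U" for y using U0[OF that] by (rule sym)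
  qed
  then have "frechet_derivative \<phi> (at x) = (\<lambda>_. 0)"
    using frechet_derivative_at by metis
  then show "partial i \<phi> x = 0" by (simp add: partial_def)
qed

section \<open>The weak equations\<close>

lemma det_complex_mult:
  "det (matrix (\<lambda>h. plane_of (d * complex_of h))) = (cmod d)\<^sup>2"
  unfolding cmod_power2 by (simp add: det_2 matrix_def axis_def power2_eq_square)

context current_sheet
begin

abbreviation rect :: "(real^2) set" where
  "rect \<equiv> cbox (vector [0, 0]) (vector [1, \<epsilon>])"

abbreviation ring :: "(real^2) set" where
  "ring \<equiv> layer {0<..<\<epsilon>}"

lemma rect_strip: "v \<in> rect \<Longrightarrow> complex_of v \<in> strip \<delta>"
  using \<epsilon> by (auto simp: mem_box_cart forall_2 strip_def)

lemma has_derivative_f_complex_of: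
  assumes "complex_of v \<in> strip \<delta>"
  shows "((\<lambda>v. f (complex_of v)) has_derivative (\<lambda>h. plane_of (deriv F (complex_of v) * complex_of h)))
    (at v within S)"
proof -
  have 1: "(complex_of has_derivative complex_of) (at v within S)"
    by (rule bounded_linear_imp_has_derivative[OF bounded_linear_complex_of])
  have "(F has_derivative (*) (deriv F (complex_of v))) (at (complex_of v))"
    using has_deriv[OF assms] by (simp add: has_field_derivative_def)
  from has_derivative_compose[OF 1 this]
  have "((\<lambda>v. F (complex_of v)) has_derivative (\<lambda>h. deriv F (complex_of v) * complex_of h)) (at v within S)" .
  from bounded_linear.has_derivative[OF bounded_linear_plane_of this]
  show ?thesis by (simp add: f_def)
qed

lemma ring_integral:
  fixes K :: "real^2 \<Rightarrow> real^2"
  assumes K: "continuous_on (layer {-\<delta><..<\<delta>}) K"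
  shows "K absolutely_integrable_on ring"
    "integral ring K = integral rect (\<lambda>v. (cmod (deriv F (complex_of v)))\<^sup>2 *\<^sub>R K (f (complex_of v)))"
proof -
  let ?g = "\<lambda>v. f (complex_of v)"
  let ?D = "\<lambda>v. (cmod (deriv F (complex_of v)))\<^sup>2 *\<^sub>R K (?g v)"
  define S where "S = rect - {v. v $ 1 = 1} - {v. v $ 2 = 0} - {v. v $ 2 = \<epsilon>}"
  have S_iff: "v \<in> S \<longleftrightarrow> 0 \<le> v $ 1 \<and> v $ 1 < 1 \<and> 0 < v $ 2 \<and> v $ 2 < \<epsilon>" for v
    by (auto simp: S_def mem_box_cart forall_2)
  have hyp: "closed {v :: real^2. v $ k = r}" for k r
    by (intro closed_Collect_eq continuous_intros)
  have neg: "negligible {v :: real^2. v $ k = r}" for k r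
    using negligible_standard_hyperplane[of "axis k 1 :: real^2" r]
    by (simp add: inner_axis axis_in_Basis_iff)
  have S_leb: "S \<in> sets lebesgue"
  proof -
    have "S \<in> sets borel"
      unfolding S_def by (intro sets.Diff borel_closed hyp closed_cbox)
    then show ?thesis by (simp add: sets_completionI_sets)
  qed
  have S_strip: "complex_of v \<in> strip \<delta>" if "v \<in> S" for v
    using that by (intro rect_strip) (simp add: S_def)
  have img: "?g ` S = ring"
  proof (intro equalityI subsetI)
    fix w assume "w \<in> ring"
    then obtain z where z: "Im z \<in> {0<..<\<epsilon>}" "w = f z" by (auto simp: layer_def)
    then have "z \<in> strip \<delta>" using \<epsilon> by (auto simp: strip_def)
    then obtain z' where z': "f z' = f z" "Im z' = Im z" "0 \<le> Re z'" "Re z' < 1"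
      using f_reduce by blast
    then show "w \<in> ?g ` S"
      using z by (intro image_eqI[of _ _ "plane_of z'"]) (auto simp: S_iff)
  qed (auto simp: S_iff layer_def)
  have inj: "inj_on ?g S"
  proof (rule inj_onI)
    fix v w assume v: "v \<in> S" and w: "w \<in> S" and "?g v = ?g w"
    then have "F (complex_of v) = F (complex_of w)" by (simp add: f_def)
    then obtain n :: int where n: "complex_of w = complex_of v + of_int n"
      using inj[OF S_strip[OF v] S_strip[OF w]] by blast
    then have "Re (complex_of w) = Re (complex_of v + of_int n)" by simp
    then have "w $ 1 = v $ 1 + of_int n" by simp
    then have "-1 < real_of_int n" "real_of_int n < 1" using v w by (auto simp: S_iff)
    then have "n = 0" by linarith
    then have "complex_of w = complex_of v" using n by simp
    then show "v = w" by (metis plane_of_complex_of)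
  qed
  have cR: "continuous_on rect (\<lambda>v. H (complex_of v))" if "continuous_on (strip \<delta>) H"
    for H :: "complex \<Rightarrow> 'x::topological_space"
    by (rule continuous_on_compose2[OF that]) (auto intro!: continuous_intros rect_strip)
  have "continuous_on (strip \<delta>) (\<lambda>z. K (f z))"
    by (rule continuous_on_compose2[OF K continuous_on_f]) (simp add: layer_strip)
  then have "continuous_on (strip \<delta>) (\<lambda>z. (cmod (deriv F z))\<^sup>2 *\<^sub>R K (f z))"
    by (intro continuous_intros holomorphic_on_imp_continuous_on[OF hol_deriv])
  from cR[OF this] have contD: "continuous_on rect ?D" .
  then have DR: "?D absolutely_integrable_on rect"
    by (rule absolutely_integrable_continuous)
  then have DS: "?D absolutely_integrable_on S"
    by (rule set_integrable_subset) (use S_leb in \<open>auto simp: S_def\<close>)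
  have "integral S ?D = integral rect ?D"
  proof (rule integral_spike_set)
    have "negligible ({v. v $ 1 = 1} \<union> {v. v $ 2 = 0} \<union> {v :: real^2. v $ 2 = \<epsilon>})"
      by (intro negligible_Un neg)
    then show "negligible {v \<in> rect - S. ?D v \<noteq> 0}"
      by (rule negligible_subset) (auto simp: S_def)
    show "negligible {v \<in> S - rect. ?D v \<noteq> 0}"
      by (rule negligible_subset[OF negligible_empty]) (auto simp: S_def)
  qed
  moreover have "?D absolutely_integrable_on S \<and> integral S ?D = b \<longleftrightarrow>
      K absolutely_integrable_on ?g ` S \<and> integral (?g ` S) K = b" for b
    using has_absolute_integral_change_of_variables[OF S_leb has_derivative_f_complex_of[OF S_strip] inj,
        of K b]
    by (simp add: det_complex_mult)
  ultimately show "K absolutely_integrable_on ring" "integral ring K = integral rect ?D"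
    using DS img by metis+
qed

lemma ring_integral_real:
  fixes K :: "real^2 \<Rightarrow> real"
  assumes K: "continuous_on (layer {-\<delta><..<\<delta>}) K"
  shows "K absolutely_integrable_on ring"
    "integral ring K = integral rect (\<lambda>v. (cmod (deriv F (complex_of v)))\<^sup>2 * K (f (complex_of v)))"
proof -
  let ?K = "\<lambda>w. plane_of (of_real (K w))"
  let ?D = "\<lambda>v. (cmod (deriv F (complex_of v)))\<^sup>2 *\<^sub>R ?K (f (complex_of v))"
  have K': "continuous_on (layer {-\<delta><..<\<delta>}) ?K"
    by (intro continuous_intros K)
  have bl: "bounded_linear (\<lambda>v :: real^2. v $ 1)" by (rule bounded_linear_vec_nth)
  note 1 = ring_integral[OF K']
  show "K absolutely_integrable_on ring"
    using absolutely_integrable_linear[OF 1(1) bl] by (simp add: o_def)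
  have "continuous_on (strip \<delta>) (\<lambda>z. K (f z))"
    by (rule continuous_on_compose2[OF K continuous_on_f]) (simp add: layer_strip)
  then have "continuous_on (strip \<delta>) (\<lambda>z. (cmod (deriv F z))\<^sup>2 *\<^sub>R ?K (f z))"
    by (intro continuous_intros holomorphic_on_imp_continuous_on[OF hol_deriv])
  then have "continuous_on rect ?D"
    by (rule continuous_on_compose2) (auto intro!: continuous_intros rect_strip)
  then have "?D integrable_on rect" by (rule integrable_continuous)
  then have "integral rect ((\<lambda>v. v $ 1) \<circ> ?D) = integral rect ?D $ 1"
    using bl by (rule integral_linear)
  moreover have "integral ring ((\<lambda>v. v $ 1) \<circ> ?K) = integral ring ?K $ 1"
    using set_lebesgue_integral_eq_integral(1)[OF 1(1)] bl by (rule integral_linear)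
  ultimately show "integral ring K = integral rect (\<lambda>v. (cmod (deriv F (complex_of v)))\<^sup>2 * K (f (complex_of v)))"
    using 1(2) by (simp add: o_def)
qed

lemma ring_sets: "ring \<in> sets lebesgue"
proof -
  have "open ring" using \<epsilon> by (intro open_layer) auto
  then show ?thesis by (simp add: borel_open sets_completionI_sets)
qed

lemma LINT_ring:
  fixes K :: "real^2 \<Rightarrow> 'b::euclidean_space"
  assumes "K absolutely_integrable_on ring" "\<And>w. w \<in> ring \<Longrightarrow> h w = K w" "\<And>w. w \<notin> ring \<Longrightarrow> h w = 0"
  shows "(LINT w|lebesgue. h w) = integral ring K"
proof -
  have "(LINT w|lebesgue. h w) = (LINT w:ring|lebesgue. K w)"
    unfolding set_lebesgue_integral_def
    by (rule Bochner_Integration.integral_cong) (use assms in \<open>auto simp: indicator_def\<close>)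
  then show ?thesis using set_lebesgue_integral_eq_integral(2)[OF assms(1)] by simp
qed

lemma locally_integrable_of_ring:
  fixes K :: "real^2 \<Rightarrow> 'b::euclidean_space"
  assumes K: "K absolutely_integrable_on ring"
    and "\<And>w. w \<in> ring \<Longrightarrow> h w = K w" "\<And>w. w \<notin> closure \<Omega> \<Longrightarrow> w \<notin> ring \<Longrightarrow> h w = 0"
  shows "locally_integrable_on h (- closure \<Omega>)"
  unfolding locally_integrable_on_def
proof (intro allI impI)
  fix C :: "(real^2) set" assume C: "compact C" "C \<subseteq> - closure \<Omega>"
  have "K absolutely_integrable_on (C \<inter> ring)"
    by (rule set_integrable_subset[OF K])
       (use C ring_sets in \<open>auto intro!: sets.Int simp: borel_compact\<close>)
  moreover have "indicator (C \<inter> ring) w *\<^sub>R K w = indicator C w *\<^sub>R h w" for w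
    using assms(2,3) C(2) by (auto simp: indicator_def)
  ultimately show "h absolutely_integrable_on C"
    unfolding set_integrable_def by simp
qed

lemma locally_integrable_ext_field: "locally_integrable_on ext_field (- closure \<Omega>)"
proof (rule locally_integrable_of_ring[OF ring_integral(1)[OF continuous_on_ring_field]])
  have l: "layer {0..<\<epsilon>} = layer {0} \<union> ring"
    using \<epsilon> by (subst layer_Un[symmetric]) (rule arg_cong[where f = layer], auto)
  show "ext_field w = ring_field w" if "w \<in> ring" for w using that l by (simp add: ext_field_def)
  show "ext_field w = 0" if "w \<notin> closure \<Omega>" "w \<notin> ring" for w
    using that l closure_\<Omega> by (auto simp: ext_field_def)
qed

lemma locally_integrable_ext_potential: "locally_integrable_on ext_potential (- closure \<Omega>)"
  by (rule locally_integrable_of_ring[OF ring_integral_real(1)[OF continuous_on_ring_potential]])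
     (auto simp: ext_potential_def)

lemma horizontal_derivative:
  assumes "\<And>w. \<phi> differentiable (at w)" "Complex x y \<in> strip \<delta>"
  shows "((\<lambda>x. \<phi> (f (Complex x y))) has_real_derivative
     Re (deriv F (Complex x y)) * partial 1 \<phi> (f (Complex x y)) +
     Im (deriv F (Complex x y)) * partial 2 \<phi> (f (Complex x y))) (at x)"
proof -
  have "((\<lambda>t. Complex t y) has_vector_derivative 1) (at x)"
    by (auto simp: Complex_eq intro!: derivative_eq_intros)
  from chain_partial[OF assms(1) has_vector_derivative_f[OF assms(2) this refl]]
  show ?thesis by (simp add: has_real_derivative_iff_has_vector_derivative)
qed

lemma vertical_derivative:
  assumes "\<And>w. \<phi> differentiable (at w)" "Complex x y \<in> strip \<delta>"
  shows "((\<lambda>y. \<phi> (f (Complex x y))) has_real_derivative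
     - Im (deriv F (Complex x y)) * partial 1 \<phi> (f (Complex x y)) +
     Re (deriv F (Complex x y)) * partial 2 \<phi> (f (Complex x y))) (at y)"
proof -
  have "((\<lambda>t. Complex x t) has_vector_derivative \<i>) (at y)"
    by (auto simp: Complex_eq intro!: derivative_eq_intros)
  from chain_partial[OF assms(1) has_vector_derivative_f[OF assms(2) this refl]]
  show ?thesis by (simp add: has_real_derivative_iff_has_vector_derivative)
qed

lemma hol_horizontal:
  assumes "H holomorphic_on strip \<delta>" "Complex x y \<in> strip \<delta>"
  shows "((\<lambda>x. H (Complex x y)) has_vector_derivative deriv H (Complex x y)) (at x)"
proof -
  have "((\<lambda>t. Complex t y) has_vector_derivative 1) (at x)"
    by (auto simp: Complex_eq intro!: derivative_eq_intros)
  from field_vector_diff_chain_at[OF this holomorphic_derivI[OF assms(1) open_strip assms(2)]]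
  show ?thesis by (simp add: o_def)
qed

lemma hol_vertical:
  assumes "H holomorphic_on strip \<delta>" "Complex x y \<in> strip \<delta>"
  shows "((\<lambda>y. H (Complex x y)) has_vector_derivative \<i> * deriv H (Complex x y)) (at y)"
proof -
  have "((\<lambda>t. Complex x t) has_vector_derivative \<i>) (at y)"
    by (auto simp: Complex_eq intro!: derivative_eq_intros)
  from field_vector_diff_chain_at[OF this holomorphic_derivI[OF assms(1) open_strip assms(2)]]
  show ?thesis by (simp add: o_def)
qed

lemma cbox_strip: "cbox 0 (Complex 1 \<epsilon>) \<subseteq> strip \<delta>"
  using \<epsilon> by (auto simp: in_cbox_complex_iff strip_def)

lemma strip_vertical: "0 \<le> y \<Longrightarrow> y \<le> \<epsilon> \<Longrightarrow> Complex x y \<in> strip \<delta>"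
  using \<epsilon> by (simp add: strip_def)

lemma continuous_on_comp_f: "continuous_on UNIV h \<Longrightarrow> continuous_on (strip \<delta>) (\<lambda>z. h (f z))"
  by (rule continuous_on_compose2[OF _ continuous_on_f]) auto

lemma f_frontier: "f (Complex x 0) \<notin> - closure \<Omega>"
  using layer_mem[of "Complex x 0" "{0}"] closure_\<Omega> by auto

lemma f_periodic: "Complex x y \<in> strip \<delta> \<Longrightarrow> f (Complex (x + 1) y) = f (Complex x y)"
proof -
  assume "Complex x y \<in> strip \<delta>"
  moreover have "Complex (x + 1) y = Complex x y + of_int 1" by (simp add: complex_eq_iff)
  ultimately show ?thesis using f_int by metis
qed

lemma deriv_periodic: "Complex x y \<in> strip \<delta> \<Longrightarrow> deriv F (Complex (x + 1) y) = deriv F (Complex x y)"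
proof -
  assume "Complex x y \<in> strip \<delta>"
  moreover have "Complex (x + 1) y = Complex x y + of_int 1" by (simp add: complex_eq_iff)
  ultimately show ?thesis using deriv_per_int by metis
qed

end

context current_sheet
begin

lemma weak_perp_grad:
  assumes \<phi>: "test_function (- closure \<Omega>) \<phi>"
  shows "(LINT w|lebesgue. \<phi> w *\<^sub>R ext_field w) = - (LINT w|lebesgue. ext_potential w *\<^sub>R perp_grad \<phi> w)"
proof -
  note smooth = test_function_smooth[OF \<phi>]
  let ?K1 = "\<lambda>w. \<phi> w *\<^sub>R ring_field w" and ?K2 = "\<lambda>w. ring_potential w *\<^sub>R perp_grad \<phi> w"
  have perp: "perp_grad \<phi> w = plane_of (Complex (- partial 2 \<phi> w) (partial 1 \<phi> w))" for w
    by (simp add: perp_grad_def plane_of_def)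
  have c1: "continuous_on (layer {-\<delta><..<\<delta>}) ?K1"
    by (intro continuous_intros smooth continuous_on_ring_field)
  have c2: "continuous_on (layer {-\<delta><..<\<delta>}) ?K2"
    unfolding perp Complex_eq by (intro continuous_intros smooth continuous_on_ring_potential)
  have c12: "continuous_on (layer {-\<delta><..<\<delta>}) (\<lambda>w. ?K1 w + ?K2 w)"
    using c1 c2 by (rule continuous_on_add)
  have l: "layer {0..<\<epsilon>} = layer {0} \<union> ring"
    using \<epsilon> by (subst layer_Un[symmetric]) (rule arg_cong[where f = layer], auto)
  have 1: "(LINT w|lebesgue. \<phi> w *\<^sub>R ext_field w) = integral ring ?K1"
  proof (rule LINT_ring[OF ring_integral(1)[OF c1]])
    fix w assume "w \<notin> ring"
    then show "\<phi> w *\<^sub>R ext_field w = 0"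
      using test_function_vanish(1)[OF \<phi>, of w] closure_\<Omega> by (auto simp: ext_field_def l)
  qed (simp add: ext_field_def l)
  have 2: "(LINT w|lebesgue. ext_potential w *\<^sub>R perp_grad \<phi> w) = integral ring ?K2"
    by (rule LINT_ring[OF ring_integral(1)[OF c2]]) (simp_all add: ext_potential_def)
  define d where "d = deriv F"
  define d2 where "d2 = deriv d"
  define p1 where "p1 z = partial 1 \<phi> (f z)" for z
  define p2 where "p2 z = partial 2 \<phi> (f z)" for z
  define \<Phi> where "\<Phi> z = \<phi> (f z)" for z
  define \<Phi>x where "\<Phi>x z = Re (d z) * p1 z + Im (d z) * p2 z" for z
  define \<Phi>y where "\<Phi>y z = - Im (d z) * p1 z + Re (d z) * p2 z" for z
  define s where "s z = complex_of_real (c * (Im z - \<epsilon>))" for z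
  define P where "P z = \<i> * s z * (d z * of_real (\<Phi> z))" for z
  define PX where "PX z = \<i> * s z * (d z * of_real (\<Phi>x z) + d2 z * of_real (\<Phi> z))" for z
  define Q where "Q z = - s z * (d z * of_real (\<Phi> z))" for z
  define QY where "QY z = - s z * (d z * of_real (\<Phi>y z) + (\<i> * d2 z) * of_real (\<Phi> z))
      - of_real c * (d z * of_real (\<Phi> z))" for z
  have hold: "d holomorphic_on strip \<delta>" unfolding d_def by (rule hol_deriv)
  have cd: "continuous_on (strip \<delta>) d" "continuous_on (strip \<delta>) d2"
    unfolding d2_def
    by (rule holomorphic_on_imp_continuous_on hold holomorphic_deriv[OF hold open_strip])+
  have c\<Phi>: "continuous_on (strip \<delta>) \<Phi>" "continuous_on (strip \<delta>) p1" "continuous_on (strip \<delta>) p2"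
    unfolding \<Phi>_def p1_def p2_def by (intro continuous_on_comp_f smooth)+
  have "continuous_on (strip \<delta>) PX" "continuous_on (strip \<delta>) QY"
    unfolding PX_def QY_def s_def \<Phi>x_def \<Phi>y_def by (intro continuous_intros cd c\<Phi>)+
  then have cPQ: "continuous_on (cbox 0 (Complex 1 \<epsilon>)) PX" "continuous_on (cbox 0 (Complex 1 \<epsilon>)) QY"
    using cbox_strip continuous_on_subset by blast+
  have "integral rect (\<lambda>v. PX (complex_of v) + QY (complex_of v)) =
      integral {0..1} (\<lambda>x. Q (Complex x \<epsilon>) - Q (Complex x 0))"
  proof (rule strip_divergence[OF \<epsilon>(1) cPQ])
    fix x y assume y: "0 \<le> y" "y \<le> \<epsilon>"
    note z = strip_vertical[OF y, of x]
    have "((\<lambda>x. of_real (\<Phi> (Complex x y)) :: complex) has_vector_derivative of_real (\<Phi>x (Complex x y))) (at x)"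
      unfolding \<Phi>_def \<Phi>x_def p1_def p2_def d_def
      by (rule has_vector_derivative_of_real[OF horizontal_derivative[OF smooth(1) z]])
    from has_vector_derivative_mult_right[OF has_vector_derivative_mult[OF hol_horizontal[OF hold z] this], of "\<i> * s (Complex x y)"]
    show "((\<lambda>x. P (Complex x y)) has_vector_derivative PX (Complex x y)) (at x)"
      unfolding P_def PX_def d2_def s_def by simp
    have \<Phi>: "((\<lambda>y. of_real (\<Phi> (Complex x y)) :: complex) has_vector_derivative of_real (\<Phi>y (Complex x y))) (at y)"
      unfolding \<Phi>_def \<Phi>y_def p1_def p2_def d_def
      by (rule has_vector_derivative_of_real[OF vertical_derivative[OF smooth(1) z]])
    have s': "((\<lambda>y. - s (Complex x y)) has_vector_derivative - of_real c) (at y)"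
      unfolding s_def by (auto intro!: derivative_eq_intros)
    show "((\<lambda>y. Q (Complex x y)) has_vector_derivative QY (Complex x y)) (at y)"
      unfolding Q_def
      by (rule has_vector_derivative_eq_rhs[OF
            has_vector_derivative_mult[OF s' has_vector_derivative_mult[OF hol_vertical[OF hold z] \<Phi>]]])
         (simp add: QY_def d2_def algebra_simps)
  next
    fix y assume "0 \<le> y" "y \<le> \<epsilon>"
    from strip_vertical[OF this, of 0]
    show "P (Complex 1 y) = P (Complex 0 y)"
      using f_periodic[of 0 y] deriv_periodic[of 0 y] by (simp add: P_def s_def d_def \<Phi>_def)
  qed
  also have "\<dots> = integral {0..1} (\<lambda>x::real. 0)"
  proof (rule Henstock_Kurzweil_Integration.integral_cong)
    fix x :: real
    have "\<Phi> (Complex x 0) = 0"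
      unfolding \<Phi>_def by (rule test_function_vanish(1)[OF \<phi> f_frontier])
    then show "Q (Complex x \<epsilon>) - Q (Complex x 0) = 0" by (simp add: Q_def s_def)
  qed
  finally have zero: "integral rect (\<lambda>v. PX (complex_of v) + QY (complex_of v)) = 0" by simp
  have id: "(cmod (d z))\<^sup>2 *\<^sub>R (?K1 (f z) + ?K2 (f z)) = plane_of (PX z + QY z)" if z: "z \<in> strip \<delta>" for z
  proof -
    have dz: "d z \<noteq> 0" unfolding d_def by (rule deriv_nonzero[OF z])
    have grad: "of_real (\<Phi>x z) + \<i> * of_real (\<Phi>y z) = cnj (d z) * Complex (p1 z) (p2 z)"
      by (simp add: complex_eq_iff \<Phi>x_def \<Phi>y_def algebra_simps)
    have sq: "complex_of_real ((cmod (d z))\<^sup>2) = d z * cnj (d z)"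
      by (rule complex_norm_square)
    have "PX z + QY z = - of_real c * d z * of_real (\<Phi> z) +
        \<i> * s z * d z * (of_real (\<Phi>x z) + \<i> * of_real (\<Phi>y z))"
      unfolding PX_def QY_def by (simp add: algebra_simps)
    also have "\<dots> = of_real ((cmod (d z))\<^sup>2) *
        (of_real (\<Phi> z) * (- of_real c / cnj (d z)) + s z * (\<i> * Complex (p1 z) (p2 z)))"
      unfolding grad sq using dz by (simp add: field_simps)
    also have "\<i> * Complex (p1 z) (p2 z) = Complex (- p2 z) (p1 z)"
      by (simp add: complex_eq_iff)
    finally have eq: "PX z + QY z = of_real ((cmod (d z))\<^sup>2) *
        (of_real (\<Phi> z) * (- of_real c / cnj (d z)) + s z * Complex (- p2 z) (p1 z))" .
    have lin: "plane_of (of_real r * w) = r *\<^sub>R plane_of w" "plane_of (w + w') = plane_of w + plane_of w'" for r w w'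
      by (simp_all add: vec_eq_iff forall_2)
    show ?thesis
      unfolding eq lin s_def
      by (simp only: ring_field_f[OF z] ring_potential_f[OF z] perp \<Phi>_def p1_def p2_def d_def)
  qed
  have "integral ring (\<lambda>w. ?K1 w + ?K2 w) =
      integral rect (\<lambda>v. (cmod (d (complex_of v)))\<^sup>2 *\<^sub>R (?K1 (f (complex_of v)) + ?K2 (f (complex_of v))))"
    using ring_integral(2)[OF c12] by (simp only: d_def)
  also have "\<dots> = integral rect (plane_of \<circ> (\<lambda>v. PX (complex_of v) + QY (complex_of v)))"
    by (rule Henstock_Kurzweil_Integration.integral_cong) (simp only: o_def id[OF rect_strip])
  also have "\<dots> = plane_of (integral rect (\<lambda>v. PX (complex_of v) + QY (complex_of v)))"
  proof (rule integral_linear[OF integrable_continuous bounded_linear_plane_of])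
    have "complex_of ` rect \<subseteq> strip \<delta>" using rect_strip by blast
    then show "continuous_on rect (\<lambda>v. PX (complex_of v) + QY (complex_of v))"
      using \<open>continuous_on (strip \<delta>) PX\<close> \<open>continuous_on (strip \<delta>) QY\<close>
      by (intro continuous_on_add continuous_on_compose2[OF _ continuous_on_complex_of[OF continuous_on_id]]) auto
  qed
  finally have "integral ring (\<lambda>w. ?K1 w + ?K2 w) = 0" by (simp add: zero)
  moreover have "integral ring (\<lambda>w. ?K1 w + ?K2 w) = integral ring ?K1 + integral ring ?K2"
    by (intro integral_add set_lebesgue_integral_eq_integral(1) ring_integral(1) c1 c2)
  ultimately show ?thesis unfolding 1 2 by (simp add: eq_neg_iff_add_eq_0)
qed

lemma weak_laplacian:
  assumes \<phi>: "test_function (- closure \<Omega>) \<phi>"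
  shows "(LINT w|lebesgue. ext_potential w * laplacian \<phi> w) = - c * integral {0..1} (\<lambda>t. \<phi> (\<Gamma> t))"
proof -
  note smooth = test_function_smooth[OF \<phi>]
  let ?K = "\<lambda>w. ring_potential w * laplacian \<phi> w"
  have cK: "continuous_on (layer {-\<delta><..<\<delta>}) ?K"
    unfolding laplacian_def by (intro continuous_intros smooth continuous_on_ring_potential)
  have 1: "(LINT w|lebesgue. ext_potential w * laplacian \<phi> w) = integral ring ?K"
    by (rule LINT_ring[OF ring_integral_real(1)[OF cK]]) (simp_all add: ext_potential_def)
  define d where "d = deriv F"
  define d2 where "d2 = deriv d"
  define p where "p i z = partial i \<phi> (f z)" for i z
  define pp where "pp i j z = partial i (partial j \<phi>) (f z)" for i j z
  define \<Phi> where "\<Phi> z = \<phi> (f z)" for z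
  define \<Phi>x where "\<Phi>x z = Re (d z) * p 1 z + Im (d z) * p 2 z" for z
  define \<Phi>y where "\<Phi>y z = - Im (d z) * p 1 z + Re (d z) * p 2 z" for z
  define px where "px i z = Re (d z) * pp 1 i z + Im (d z) * pp 2 i z" for i z
  define py where "py i z = - Im (d z) * pp 1 i z + Re (d z) * pp 2 i z" for i z
  define s where "s z = c * (Im z - \<epsilon>)" for z
  define P where "P z = s z * \<Phi>x z" for z
  define PX where "PX z = s z * (Re (d2 z) * p 1 z + Re (d z) * px 1 z + Im (d2 z) * p 2 z + Im (d z) * px 2 z)" for z
  define Q where "Q z = s z * \<Phi>y z - c * \<Phi> z" for z
  define QY where "QY z = s z * (- Re (d2 z) * p 1 z - Im (d z) * py 1 z - Im (d2 z) * p 2 z + Re (d z) * py 2 z)" for z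
  have hold: "d holomorphic_on strip \<delta>" unfolding d_def by (rule hol_deriv)
  have cd: "continuous_on (strip \<delta>) d" "continuous_on (strip \<delta>) d2"
    unfolding d2_def
    by (rule holomorphic_on_imp_continuous_on hold holomorphic_deriv[OF hold open_strip])+
  have c\<Phi>: "continuous_on (strip \<delta>) (p i)" "continuous_on (strip \<delta>) (pp i j)" for i j
    unfolding p_def pp_def by (intro continuous_on_comp_f smooth)+
  have "continuous_on (strip \<delta>) PX" "continuous_on (strip \<delta>) QY"
    unfolding PX_def QY_def s_def px_def py_def by (intro continuous_intros cd c\<Phi>)+
  then have cPQ: "continuous_on (cbox 0 (Complex 1 \<epsilon>)) PX" "continuous_on (cbox 0 (Complex 1 \<epsilon>)) QY"
    using cbox_strip continuous_on_subset by blast+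
  have "integral rect (\<lambda>v. PX (complex_of v) + QY (complex_of v)) =
      integral {0..1} (\<lambda>x. Q (Complex x \<epsilon>) - Q (Complex x 0))"
  proof (rule strip_divergence[OF \<epsilon>(1) cPQ])
    fix x y assume y: "0 \<le> y" "y \<le> \<epsilon>"
    note z = strip_vertical[OF y, of x]
    have ph: "((\<lambda>x. p i (Complex x y)) has_real_derivative px i (Complex x y)) (at x)" for i
      unfolding p_def px_def pp_def d_def by (rule horizontal_derivative[OF smooth(2) z])
    have pv: "((\<lambda>y. p i (Complex x y)) has_real_derivative py i (Complex x y)) (at y)" for i
      unfolding p_def py_def pp_def d_def by (rule vertical_derivative[OF smooth(2) z])
    have \<Phi>v: "((\<lambda>y. \<Phi> (Complex x y)) has_real_derivative \<Phi>y (Complex x y)) (at y)"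
      unfolding \<Phi>_def \<Phi>y_def p_def d_def by (rule vertical_derivative[OF smooth(1) z])
    have dh: "((\<lambda>x. Re (d (Complex x y))) has_real_derivative Re (d2 (Complex x y))) (at x)"
      "((\<lambda>x. Im (d (Complex x y))) has_real_derivative Im (d2 (Complex x y))) (at x)"
      using bounded_linear.has_vector_derivative[OF bounded_linear_Re hol_horizontal[OF hold z]]
        bounded_linear.has_vector_derivative[OF bounded_linear_Im hol_horizontal[OF hold z]]
      by (simp_all add: has_real_derivative_iff_has_vector_derivative d2_def)
    have dv: "((\<lambda>y. Re (d (Complex x y))) has_real_derivative - Im (d2 (Complex x y))) (at y)"
      "((\<lambda>y. Im (d (Complex x y))) has_real_derivative Re (d2 (Complex x y))) (at y)"
      using bounded_linear.has_vector_derivative[OF bounded_linear_Re hol_vertical[OF hold z]]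
        bounded_linear.has_vector_derivative[OF bounded_linear_Im hol_vertical[OF hold z]]
      by (simp_all add: has_real_derivative_iff_has_vector_derivative d2_def)
    have "((\<lambda>x. P (Complex x y)) has_real_derivative PX (Complex x y)) (at x)"
      using DERIV_cmult[OF DERIV_add[OF DERIV_mult[OF dh(1) ph[of 1]] DERIV_mult[OF dh(2) ph[of 2]]],
          of "s (Complex x y)"]
      unfolding P_def \<Phi>x_def s_def complex.sel
      by (rule DERIV_cong) (simp add: PX_def s_def algebra_simps)
    then show "((\<lambda>x. P (Complex x y)) has_vector_derivative PX (Complex x y)) (at x)"
      by (simp add: has_real_derivative_iff_has_vector_derivative)
    have s': "((\<lambda>y. s (Complex x y)) has_real_derivative c) (at y)"
      unfolding s_def by (auto intro!: derivative_eq_intros)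
    have "((\<lambda>y. Q (Complex x y)) has_real_derivative
        c * \<Phi>y (Complex x y) + QY (Complex x y) - c * \<Phi>y (Complex x y)) (at y)"
      using DERIV_diff[OF DERIV_mult[OF s' DERIV_add[OF DERIV_mult[OF DERIV_minus[OF dv(2)] pv[of 1]]
            DERIV_mult[OF dv(1) pv[of 2]]]] DERIV_cmult[OF \<Phi>v, of c]]
      unfolding Q_def \<Phi>y_def
      by (rule DERIV_cong) (simp add: QY_def \<Phi>y_def algebra_simps)
    then show "((\<lambda>y. Q (Complex x y)) has_vector_derivative QY (Complex x y)) (at y)"
      by (simp add: has_real_derivative_iff_has_vector_derivative)
  next
    fix y assume "0 \<le> y" "y \<le> \<epsilon>"
    from strip_vertical[OF this, of 0]
    show "P (Complex 1 y) = P (Complex 0 y)"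
      using f_periodic[of 0 y] deriv_periodic[of 0 y] by (simp add: P_def s_def d_def \<Phi>x_def p_def)
  qed
  also have "\<dots> = integral {0..1} (\<lambda>t. - c * \<phi> (\<Gamma> t))"
  proof (rule Henstock_Kurzweil_Integration.integral_cong)
    fix x :: real
    have "\<Phi> (Complex x 0) = 0" "p i (Complex x 0) = 0" for i
      unfolding \<Phi>_def p_def by (rule test_function_vanish[OF \<phi> f_frontier])+
    then show "Q (Complex x \<epsilon>) - Q (Complex x 0) = - c * \<phi> (\<Gamma> x)"
      by (simp add: Q_def s_def \<Phi>y_def \<Phi>_def \<Gamma>_def)
  qed
  finally have flux: "integral rect (\<lambda>v. PX (complex_of v) + QY (complex_of v)) =
      - c * integral {0..1} (\<lambda>t. \<phi> (\<Gamma> t))" by simp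
  have id: "(cmod (d z))\<^sup>2 * ?K (f z) = PX z + QY z" if z: "z \<in> strip \<delta>" for z
    unfolding ring_potential_f[OF z] laplacian_def PX_def QY_def px_def py_def cmod_power2 s_def pp_def
    by (simp add: algebra_simps power2_eq_square)
  have "integral ring ?K = integral rect (\<lambda>v. (cmod (d (complex_of v)))\<^sup>2 * ?K (f (complex_of v)))"
    using ring_integral_real(2)[OF cK] by (simp only: d_def)
  also have "\<dots> = integral rect (\<lambda>v. PX (complex_of v) + QY (complex_of v))"
    by (rule Henstock_Kurzweil_Integration.integral_cong) (simp only: id[OF rect_strip])
  finally show ?thesis unfolding 1 flux .
qed

lemma \<Gamma>_derivative: "vector_derivative \<Gamma> (at t) = plane_of (deriv F (Complex t \<epsilon>))"
  unfolding \<Gamma>_eq using \<epsilon> by (intro vector_derivative_at vector_derivative_horizontal) auto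

lemma continuous_on_\<Gamma>: "continuous_on S \<Gamma>"
  unfolding \<Gamma>_eq Complex_eq
  by (rule continuous_on_compose2[OF continuous_on_f])
     (use \<epsilon> in \<open>auto simp: strip_def intro!: continuous_intros\<close>)

lemma continuous_on_\<Gamma>_speed: "continuous_on S (\<lambda>t. norm (vector_derivative \<Gamma> (at t)))"
  unfolding \<Gamma>_derivative norm_plane_of Complex_eq
  by (intro continuous_on_norm continuous_on_compose2[OF holomorphic_on_imp_continuous_on[OF hol_deriv]])
     (use \<epsilon> in \<open>auto simp: strip_def intro!: continuous_intros\<close>)

lemma sheet_current_\<Gamma>: "norm (vector_derivative \<Gamma> (at t)) * sheet_current (\<Gamma> t) = - c"
proof -
  have z: "Complex t \<epsilon> \<in> strip \<delta>" using \<epsilon> by (simp add: strip_def)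
  have "\<Gamma> t \<in> layer {\<epsilon>}" unfolding \<Gamma>_def by (rule layer_mem) simp
  then show ?thesis
    using deriv_nonzero[OF z] c_pos
    by (simp add: sheet_current_def \<Gamma>_derivative \<Gamma>_def norm_ring_field[OF z])
qed

lemma sheet_current_measurable: "sheet_current \<in> borel_measurable borel"
  unfolding sheet_current_def
proof (rule borel_measurable_continuous_on_if)
  have "compact (layer {\<epsilon>..\<epsilon>})" using \<epsilon> by (intro compact_layer) auto
  then show "layer {\<epsilon>} \<in> sets borel" by (simp add: borel_compact)
  show "continuous_on (layer {\<epsilon>}) (\<lambda>w. - norm (ring_field w))"
    by (intro continuous_intros continuous_on_subset[OF continuous_on_ring_field] layer_mono) (use \<epsilon> in auto)
qed auto

lemma integral_arclength:
  fixes h :: "real^2 \<Rightarrow> real"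
  assumes h: "h \<in> borel_measurable borel"
    and g: "continuous_on {0..1} g" "\<And>t. t \<in> {0..1} \<Longrightarrow> norm (vector_derivative \<Gamma> (at t)) * h (\<Gamma> t) = g t"
  shows "integrable (arclength_measure \<Gamma>) h" "(LINT w|arclength_measure \<Gamma>. h w) = integral {0..1} g"
proof -
  let ?s = "\<lambda>t. norm (vector_derivative \<Gamma> (at t))"
  let ?M = "restrict_space lborel {0..1::real}"
  have m\<Gamma>: "\<Gamma> \<in> borel_measurable borel"
    by (rule borel_measurable_continuous_onI[OF continuous_on_\<Gamma>])
  have ms: "?s \<in> borel_measurable borel"
    by (rule borel_measurable_continuous_onI[OF continuous_on_\<Gamma>_speed])
  have m1: "\<Gamma> \<in> measurable ?M borel" "?s \<in> borel_measurable ?M" "(\<lambda>t. h (\<Gamma> t)) \<in> borel_measurable ?M"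
    using m\<Gamma> ms measurable_compose[OF m\<Gamma> h] by (auto intro!: measurable_restrict_space1)
  have m2: "\<Gamma> \<in> measurable (density ?M (\<lambda>t. ennreal (?s t))) borel"
    using m1(1) by simp
  have g_int: "set_integrable lborel {0..1} g"
    using borel_integrable_compact[OF _ g(1)] by (simp add: set_integrable_def)
  have ind: "indicator {0..1} t *\<^sub>R (?s t * h (\<Gamma> t)) = indicator {0..1} t *\<^sub>R g t" for t
    using g(2)[of t] by (auto simp: indicator_def)
  have "integrable (arclength_measure \<Gamma>) h \<longleftrightarrow> integrable ?M (\<lambda>t. ?s t * h (\<Gamma> t))"
    unfolding arclength_measure_def integrable_distr_eq[OF m2 h]
    using integrable_density[OF m1(3) m1(2)] by simp
  also have "\<dots> \<longleftrightarrow> integrable lborel (\<lambda>t. indicator {0..1} t *\<^sub>R (?s t * h (\<Gamma> t)))"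
    by (rule integrable_restrict_space) simp
  finally show "integrable (arclength_measure \<Gamma>) h"
    using g_int by (simp only: ind set_integrable_def)
  have "(LINT w|arclength_measure \<Gamma>. h w) = (LINT t|?M. ?s t * h (\<Gamma> t))"
    unfolding arclength_measure_def integral_distr[OF m2 h]
    using integral_density[OF m1(3) m1(2)] by simp
  also have "\<dots> = (LINT t|lborel. indicator {0..1} t *\<^sub>R (?s t * h (\<Gamma> t)))"
    by (rule integral_restrict_space) simp
  also have "\<dots> = (LINT t:{0..1}|lborel. g t)"
    by (simp only: ind set_lebesgue_integral_def)
  also have "\<dots> = integral {0..1} g"
    using g_int by (rule set_borel_integral_eq_integral(2))
  finally show "(LINT w|arclength_measure \<Gamma>. h w) = integral {0..1} g" .
qed

lemma ext_field_generated: "generated_by_current_sheet \<Omega> \<Gamma> sheet_current ext_field"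
  unfolding generated_by_current_sheet_def
proof (intro conjI exI[of _ ext_potential] allI impI)
  show "integrable (arclength_measure \<Gamma>) sheet_current"
    by (rule integral_arclength(1)[OF sheet_current_measurable, of "\<lambda>_. - c"])
       (simp_all add: sheet_current_\<Gamma>)
  fix \<phi> assume \<phi>: "test_function (- closure \<Omega>) \<phi>"
  show "(LINT w|lebesgue. \<phi> w *\<^sub>R ext_field w) = - (LINT w|lebesgue. ext_potential w *\<^sub>R perp_grad \<phi> w)"
    using \<phi> by (rule weak_perp_grad)
  have c\<phi>: "continuous_on S \<phi>" for S by (rule test_function_smooth(3)[OF \<phi>])
  have "(LINT w|arclength_measure \<Gamma>. sheet_current w * \<phi> w) = integral {0..1} (\<lambda>t. - c * \<phi> (\<Gamma> t))"
  proof (rule integral_arclength(2))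
    show "(\<lambda>w. sheet_current w * \<phi> w) \<in> borel_measurable borel"
      using sheet_current_measurable borel_measurable_continuous_onI[OF c\<phi>] by (rule borel_measurable_times)
    show "continuous_on {0..1} (\<lambda>t. - c * \<phi> (\<Gamma> t))"
      by (intro continuous_intros continuous_on_compose2[OF c\<phi> continuous_on_\<Gamma>]) auto
    show "norm (vector_derivative \<Gamma> (at t)) * (sheet_current (\<Gamma> t) * \<phi> (\<Gamma> t)) = - c * \<phi> (\<Gamma> t)" for t
      using sheet_current_\<Gamma>[of t] by (metis mult.assoc)
  qed
  then show "(LINT w|lebesgue. ext_potential w * laplacian \<phi> w) = (LINT w|arclength_measure \<Gamma>. sheet_current w * \<phi> w)"
    using weak_laplacian[OF \<phi>] by simp
qed (simp_all add: \<Gamma>_outside \<Omega>_inside continuous_on_ext_field locally_integrable_ext_field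
      locally_integrable_ext_potential ext_field_at_infinity)

end

section \<open>Boundary values\<close>

lemma boundary_pressure:
  assumes \<Omega>: "open \<Omega>" and sol: "analytic_MHD_solution \<Omega> u B p"
    and \<psi>: "stream_function \<Omega> \<psi> u" and A: "stream_function \<Omega> A B"
    and A0: "\<forall>x\<in>frontier \<Omega>. A x = 0"
    and k: "k \<ge> 2" and G: "Ck_on k G UNIV" and H: "Ck_on (k - 1) H UNIV"
    and GA: "\<forall>x\<in>\<Omega>. \<psi> x = G (A x)"
    and Ber: "\<forall>x\<in>\<Omega>. p x + (norm (u x))\<^sup>2 / 2 - (norm (B x))\<^sup>2 / 2 = H (A x)"
    and x: "x \<in> frontier \<Omega>"
  shows "2 * p x = 2 * H 0 + (1 - \<bar>deriv G 0\<bar>\<^sup>2) * (norm (B x))\<^sup>2"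
proof -
  obtain m where m: "k = Suc (Suc m)" using k by (metis add_2_eq_Suc le_Suc_ex)
  have Gd: "G differentiable (at y)" for y :: real using G m by simp
  have "Ck_on (Suc m) (\<lambda>y. frechet_derivative G (at y) 1) UNIV" using G m by simp
  then have "(\<lambda>y. frechet_derivative G (at y) 1) differentiable (at y)" for y :: real by simp
  moreover have dG: "(G has_real_derivative deriv G y) (at y)" for y
    using Gd[of y] by (simp add: DERIV_deriv_iff_real_differentiable)
  have "frechet_derivative G (at y) 1 = deriv G y" for y
    using dG[of y] frechet_derivative_at[of G "(*) (deriv G y)" y]
    unfolding has_field_derivative_def by (metis mult.right_neutral)
  ultimately have "deriv G differentiable (at y)" for y by simp
  then have cG: "continuous_on UNIV (deriv G)"
    by (meson continuous_at_imp_continuous_on differentiable_imp_continuous_within)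
  have "H differentiable (at y)" for y :: real using H m by simp
  then have cH: "continuous_on UNIV H"
    by (meson continuous_at_imp_continuous_on differentiable_imp_continuous_within)
  have cA: "continuous_on (closure \<Omega>) A" using A by (simp add: stream_function_def)
  have "continuous_on (closure \<Omega>) B" "continuous_on (closure \<Omega>) p"
    using sol real_analytic_isCont unfolding analytic_MHD_solution_def
    by (blast intro: continuous_at_imp_continuous_on)+
  then have cont: "continuous_on (closure \<Omega>)
     (\<lambda>y. 2 * p y - 2 * H (A y) - (1 - \<bar>deriv G (A y)\<bar>\<^sup>2) * (norm (B y))\<^sup>2)"
    by (intro continuous_intros continuous_on_compose2[OF cG cA] continuous_on_compose2[OF cH cA]) auto
  have "2 * p y - 2 * H (A y) - (1 - \<bar>deriv G (A y)\<bar>\<^sup>2) * (norm (B y))\<^sup>2 = 0" if y: "y \<in> \<Omega>" for y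
  proof -
    have "A differentiable (at y)" using A y by (simp add: stream_function_def)
    then have dA: "(A has_derivative frechet_derivative A (at y)) (at y)"
      by (simp add: frechet_derivative_works)
    have "((\<lambda>y. G (A y)) has_derivative (\<lambda>h. deriv G (A y) * frechet_derivative A (at y) h)) (at y)"
      using has_derivative_compose[OF dA, of G "(*) (deriv G (A y))"] dG[of "A y"]
      by (simp add: has_field_derivative_def)
    then have "(\<psi> has_derivative (\<lambda>h. deriv G (A y) * frechet_derivative A (at y) h)) (at y)"
      by (rule has_derivative_transform_within_open[OF _ \<Omega> y]) (simp add: GA)
    then have "frechet_derivative \<psi> (at y) = (\<lambda>h. deriv G (A y) * frechet_derivative A (at y) h)"
      using frechet_derivative_at by metis
    then have "perp_grad \<psi> y = deriv G (A y) *\<^sub>R perp_grad A y"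
      by (simp add: perp_grad_def partial_def vec_eq_iff forall_2)
    then have "u y = deriv G (A y) *\<^sub>R B y"
      using \<psi> A y by (simp add: stream_function_def)
    then show ?thesis
      using Ber[rule_format, OF y] by (simp add: power_mult_distrib algebra_simps)
  qed
  from continuous_constant_on_closure[OF cont this] x
  have "2 * p x - 2 * H (A x) - (1 - \<bar>deriv G (A x)\<bar>\<^sup>2) * (norm (B x))\<^sup>2 = 0"
    by (simp add: frontier_def)
  then show ?thesis using A0 x by simp
qed

lemma complex_of_scaleR: "complex_of (r *\<^sub>R v) = of_real r * complex_of v"
  by (simp add: complex_eq_iff)

section \<open>Parametrization of the boundary by the flux\<close>

lemma simple_path_periodic_eq:
  assumes "simple_path \<gamma>" and per: "\<And>t. \<gamma> (t + 1) = \<gamma> t" and eq: "\<gamma> s = \<gamma> t"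
  shows "\<exists>n::int. t = s + of_int n"
proof -
  define s' where "s' = s + of_int (- \<lfloor>s\<rfloor>)"
  define t' where "t' = t + of_int (- \<lfloor>t\<rfloor>)"
  have "\<gamma> s' = \<gamma> t'"
    unfolding s'_def t'_def periodic_int[of \<gamma>, OF per] by (rule eq)
  moreover have b: "0 \<le> s'" "s' < 1" "0 \<le> t'" "t' < 1"
    unfolding s'_def t'_def by simp_all linarith+
  ultimately have "s' = t' \<or> s' = 0 \<and> t' = 1 \<or> s' = 1 \<and> t' = 0"
    using assms(1) unfolding simple_path_def loop_free_def by (meson atLeastAtMost_iff less_imp_le)
  then have "s' = t'" using b by auto
  then have "t = s + of_int (\<lfloor>t\<rfloor> - \<lfloor>s\<rfloor>)" by (simp add: s'_def t'_def)
  then show ?thesis by blast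
qed

lemma antiderivative_exists:
  fixes h :: "real \<Rightarrow> real"
  assumes "continuous_on UNIV h"
  obtains T where "\<And>x. (T has_real_derivative h x) (at x)" "T 0 = 0"
proof
  define T where "T x = (LBINT y=0..x. h y)" for x :: real
  show "(T has_real_derivative h x) (at x)" for x
  proof -
    let ?a = "- \<bar>x\<bar> - 1" and ?b = "\<bar>x\<bar> + 1"
    have "((\<lambda>u. LBINT y=0..u. h y) has_vector_derivative h x) (at x within {?a..?b})"
      unfolding zero_ereal_def
      by (rule interval_integral_FTC2) (use assms continuous_on_subset in auto)
    then have "(T has_vector_derivative h x) (at x within {?a..?b})" by (simp add: T_def[abs_def])
    moreover have "at x within {?a..?b} = at x" by (rule at_within_interior) (auto simp: interior_atLeastAtMost_real)
    ultimately show ?thesis by (simp add: has_real_derivative_iff_has_vector_derivative)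
  qed
  show "T 0 = 0" by (simp add: T_def zero_ereal_def)
qed

lemma flux_reparametrization:
  fixes h :: "real \<Rightarrow> real"
  assumes ext: "\<And>t. hol_ext_at (\<lambda>s. of_real (h s)) t" and per: "\<And>t. h (t + 1) = h t"
    and pos: "\<And>t. h t > 0"
  obtains c T S where "c > 0"
    "\<forall>t. (T has_real_derivative h t / c) (at t)" "\<forall>t. T (t + 1) = T t + 1"
    "\<forall>t. S (T t) = t" "\<forall>t. T (S t) = t" "\<forall>t. isCont S t" "\<forall>t. hol_ext_at (\<lambda>s. of_real (S s)) t"
proof -
  have "isCont h t" for t
  proof -
    have "isCont (\<lambda>s. complex_of_real (h s)) t"
      using hol_ext_at_derivative(1)[OF ext] by (rule differentiable_imp_continuous_within)
    then have "isCont (\<lambda>s. Re (complex_of_real (h s))) t" by (rule continuous_Re)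
    then show ?thesis by simp
  qed
  then have "continuous_on UNIV h" by (simp add: continuous_at_imp_continuous_on)
  then obtain T0 where T0: "\<And>x. (T0 has_real_derivative h x) (at x)" "T0 0 = 0"
    using antiderivative_exists by blast
  define c where "c = T0 1"
  have T0_less: "T0 x < T0 y" if "x < y" for x y
    by (rule DERIV_pos_imp_increasing[OF that]) (use T0(1) pos in blast)
  have c: "c > 0" using T0_less[of 0 1] T0(2) by (simp add: c_def)
  have T0_per: "T0 (t + 1) = T0 t + c" for t
  proof -
    have "((\<lambda>t. T0 (t + 1) - T0 t) has_real_derivative h (x + 1) - h x) (at x)" for x
      using T0(1)[of "x + 1"] T0(1)[of x] by (intro DERIV_diff) (simp_all add: DERIV_shift)
    then have "\<forall>x. ((\<lambda>t. T0 (t + 1) - T0 t) has_real_derivative 0) (at x)" by (simp add: per)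
    then have "T0 (t + 1) - T0 t = T0 (0 + 1) - T0 0" by (rule DERIV_isconst_all)
    then show ?thesis by (simp add: c_def T0(2))
  qed
  define T where "T t = T0 t / c" for t
  have dT: "(T has_real_derivative h t / c) (at t)" for t
    unfolding T_def using T0(1) by (rule DERIV_cdivide)
  have T_per: "T (t + 1) = T t + 1" for t
    using c by (simp add: T_def T0_per add_divide_distrib)
  have T_less: "T x < T y" if "x < y" for x y using T0_less[OF that] c by (simp add: T_def divide_strict_right_mono)
  have T_cont: "isCont T t" for t using dT by (rule DERIV_isCont)
  have T_int: "T (of_int n) = of_int n" for n
    using periodic_int[of "\<lambda>t. T t - t" 0 n] T_per by (simp add: T_def T0(2))
  have "\<exists>t. T t = y" for y
  proof -
    have "\<exists>t\<ge>of_int \<lfloor>y\<rfloor>. t \<le> of_int (\<lfloor>y\<rfloor> + 1) \<and> T t = y"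
      by (rule IVT) (use T_int T_cont in \<open>auto simp del: of_int_add, linarith+\<close>)
    then show ?thesis by blast
  qed
  then obtain S where TS: "\<And>y. T (S y) = y" by metis
  have ST: "S (T t) = t" for t
    using TS[of "T t"] T_less by (metis less_irrefl linorder_neqE_linordered_idom)
  have S_cont: "isCont S t" for t
    using isCont_inverse_function[of 1 "S t" S T] ST T_cont by (simp add: TS)
  have "hol_ext_at (\<lambda>s. of_real (S s)) t" for t
  proof -
    have "hol_ext_at (\<lambda>s. of_real (T s)) (S t)"
    proof (rule hol_ext_at_antiderivative)
      show "hol_ext_at (\<lambda>s. of_real (h s) * of_real (1 / c)) (S t)"
        by (intro hol_ext_at_mult ext hol_ext_at_const)
      show "((\<lambda>s. complex_of_real (T s)) has_vector_derivative of_real (h x) * of_real (1 / c)) (at x)" for x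
        using has_vector_derivative_of_real[OF dT[of x], where 'a = complex] by simp
    qed
    from hol_ext_at_inverse[OF this dT, of S] show ?thesis
      using pos[of "S t"] c ST TS S_cont by simp
  qed
  then show thesis using that[of c T S] c dT T_per ST TS S_cont by blast
qed

lemma hol_ext_at_curve:
  fixes \<gamma> :: "real \<Rightarrow> 'b::euclidean_space"
  assumes \<gamma>: "real_analytic_on \<gamma> UNIV"
  shows "hol_ext_at (\<lambda>s. complex_of_real (\<gamma> s \<bullet> e)) t"
  by (rule hol_ext_at_real_analytic[OF \<gamma>, of "\<lambda>s. s"]) (auto intro: hol_ext_at_of_real)

lemma conformal_boundary_parametrization:
  assumes \<gamma>: "analytic_Jordan_param \<gamma>"
    and p: "real_analytic_on p (path_image \<gamma>)" and pos: "\<And>x. x \<in> path_image \<gamma> \<Longrightarrow> p x > 0"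
  obtains F \<delta> c where "conformal_strip F \<delta>" "c > 0"
    "range (\<lambda>t. plane_of (F (of_real t))) = path_image \<gamma>"
    "\<And>t. 2 * p (plane_of (F (of_real t))) = (c / cmod (deriv F (of_real t)))\<^sup>2"
proof -
  have an: "real_analytic_on \<gamma> UNIV" and simple: "simple_path \<gamma>" and per: "\<And>t. \<gamma> (t + 1) = \<gamma> t"
    and diff: "\<And>t. \<gamma> differentiable (at t)" and nz: "\<And>t. vector_derivative \<gamma> (at t) \<noteq> 0"
    using \<gamma> by (auto simp: analytic_Jordan_param_def regular_Jordan_param_def)
  define v where "v t = vector_derivative \<gamma> (at t)" for t
  have dv: "(\<gamma> has_vector_derivative v t) (at t)" for t
    unfolding v_def using diff by (simp add: vector_derivative_works)
  have on: "\<gamma> t \<in> path_image \<gamma>" for t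
  proof -
    have "\<gamma> t = \<gamma> (t + of_int (- \<lfloor>t\<rfloor>))" by (simp only: periodic_int[of \<gamma>, OF per])
    moreover have "t + of_int (- \<lfloor>t\<rfloor>) \<in> {0..1}" by simp linarith
    ultimately show ?thesis unfolding path_image_def by (metis image_eqI)
  qed
  have cont: "isCont \<gamma> t" for t using dv by (rule has_vector_derivative_continuous)
  have v_per: "v (t + 1) = v t" for t
  proof -
    have "((\<lambda>s. s + 1) has_vector_derivative 1) (at t)"
      by (auto intro!: derivative_eq_intros)
    from vector_diff_chain_at[OF this dv] have "(\<gamma> has_vector_derivative v (t + 1)) (at t)"
      by (simp add: o_def per)
    then show ?thesis using dv[of t] by (rule vector_derivative_unique_at)
  qed
  have v_ext: "hol_ext_at (\<lambda>s. of_real (v s $ i)) t" for i t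
  proof -
    have "vector_derivative (\<lambda>s. complex_of_real (\<gamma> s $ i)) (at s) = of_real (v s $ i)" for s
      using bounded_linear.has_vector_derivative[OF bounded_linear_vec_nth dv]
      by (intro vector_derivative_at has_vector_derivative_of_real)
         (simp add: has_real_derivative_iff_has_vector_derivative)
    moreover have "hol_ext_at (\<lambda>s. complex_of_real (\<gamma> s $ i)) t"
      using hol_ext_at_curve[OF an, of "axis i 1"] by (simp add: inner_axis)
    ultimately show ?thesis using hol_ext_at_derivative(2) by fastforce
  qed
  define h where "h t = sqrt (2 * p (\<gamma> t) * (norm (v t))\<^sup>2)" for t
  have arg_pos: "2 * p (\<gamma> t) * (norm (v t))\<^sup>2 > 0" for t
    using pos[OF on] nz by (simp add: v_def)
  have h_ext: "hol_ext_at (\<lambda>s. of_real (h s)) t" for t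
  proof -
    have 1: "hol_ext_at (\<lambda>s. of_real (p (\<gamma> s) \<bullet> 1)) t"
      using p on by (rule hol_ext_at_real_analytic) (auto intro: hol_ext_at_curve[OF an] cont)
    have "hol_ext_at (\<lambda>s. 2 * of_real (p (\<gamma> s) \<bullet> 1) *
        (of_real (v s $ 1) * of_real (v s $ 1) + of_real (v s $ 2) * of_real (v s $ 2))) t"
      by (intro hol_ext_at_mult hol_ext_at_add hol_ext_at_const 1 v_ext)
    moreover have "2 * complex_of_real (p (\<gamma> s) \<bullet> 1) *
        (of_real (v s $ 1) * of_real (v s $ 1) + of_real (v s $ 2) * of_real (v s $ 2)) =
        of_real (2 * p (\<gamma> s) * (norm (v s))\<^sup>2)" for s
      by (simp add: norm_vec_def L2_set_def sum_2 power2_eq_square)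
    ultimately have "hol_ext_at (\<lambda>s. of_real (2 * p (\<gamma> s) * (norm (v s))\<^sup>2)) t" by (simp only:)
    then have "hol_ext_at (\<lambda>s. csqrt (of_real (2 * p (\<gamma> s) * (norm (v s))\<^sup>2))) t"
      by (rule hol_ext_at_compose[OF _ analytic_on_subset[OF analytic_on_csqrt]])
         (use arg_pos[of t] in \<open>simp add: complex_nonpos_Reals_iff del: of_real_mult of_real_power\<close>)
    moreover have "csqrt (of_real (2 * p (\<gamma> s) * (norm (v s))\<^sup>2)) = of_real (h s)" for s
      unfolding h_def using arg_pos[of s] by (intro csqrt_of_real less_imp_le)
    ultimately show ?thesis by (simp only:)
  qed
  have h_per: "h (t + 1) = h t" for t by (simp add: h_def per v_per)
  have h_pos: "h t > 0" for t using arg_pos[of t] by (simp add: h_def)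
  obtain c T S where c: "c > 0"
    and T': "\<forall>t. (T has_real_derivative h t / c) (at t)" "\<forall>t. T (t + 1) = T t + 1"
    and S': "\<forall>t. S (T t) = t" "\<forall>t. T (S t) = t" "\<forall>t. isCont S t" "\<forall>t. hol_ext_at (\<lambda>s. of_real (S s)) t"
    using flux_reparametrization[of h, OF h_ext h_per h_pos] .
  note T = T'[rule_format] and S = S'[rule_format]
  have dS: "(S has_real_derivative c / h (S t)) (at t)" for t
  proof -
    have "(S has_real_derivative inverse (h (S t) / c)) (at t)"
      by (rule DERIV_inverse_function[where f = T and a = "t - 1" and b = "t + 1"])
         (use T(1) S h_pos[of "S t"] c in \<open>auto\<close>)
    then show ?thesis by simp
  qed
  define b where "b t = complex_of (\<gamma> (S t))" for t
  have S_per: "S (t + 1) = S t + 1" for t using S(1)[of "S t + 1"] by (simp add: T(2) S(2))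
  have b_per: "b (t + 1) = b t" for t by (simp add: b_def S_per per)
  have b_ext: "hol_ext_at b t" for t
  proof -
    have "hol_ext_at (\<lambda>s. of_real (\<gamma> s \<bullet> axis 1 1) + \<i> * of_real (\<gamma> s \<bullet> axis 2 1)) (S t)"
      by (intro hol_ext_at_mult hol_ext_at_add hol_ext_at_const hol_ext_at_curve an)
    moreover have "(\<lambda>s. of_real (\<gamma> s \<bullet> axis 1 1) + \<i> * of_real (\<gamma> s \<bullet> axis 2 1)) = (\<lambda>s. complex_of (\<gamma> s))"
      by (auto simp: complex_eq_iff inner_axis)
    ultimately have "hol_ext_at (\<lambda>s. complex_of (\<gamma> s)) (S t)" by (simp only:)
    from hol_ext_at_compose_real[OF S(4) this S(3)] show ?thesis
      unfolding b_def[abs_def] .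
  qed
  have db: "(b has_vector_derivative of_real (c / h (S t)) * complex_of (v (S t))) (at t)" for t
  proof -
    have "((\<gamma> \<circ> S) has_vector_derivative (c / h (S t)) *\<^sub>R v (S t)) (at t)"
      using dS dv by (intro vector_diff_chain_at) (auto simp: has_real_derivative_iff_has_vector_derivative)
    from bounded_linear.has_vector_derivative[OF bounded_linear_complex_of this]
    show ?thesis
      unfolding b_def[abs_def] by (simp add: complex_of_scaleR)
  qed
  obtain \<delta>0 F where F: "\<delta>0 > 0" "F holomorphic_on strip \<delta>0" "\<And>x. F (of_real x) = b x"
    "\<And>z. z \<in> strip \<delta>0 \<Longrightarrow> F (z + 1) = F z"
    by (rule periodic_hol_extension[OF b_ext b_per]) blast
  have dF: "deriv F (of_real t) = of_real (c / h (S t)) * complex_of (v (S t))" for t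
  proof -
    have "(F has_field_derivative deriv F (of_real t)) (at (of_real t))"
      using F(1) by (intro holomorphic_derivI[OF F(2) open_strip]) (simp add: strip_def)
    then have "((\<lambda>t. F (of_real t)) has_vector_derivative deriv F (of_real t)) (at t)"
      by (rule has_vector_derivative_real_field)
    then have "(b has_vector_derivative deriv F (of_real t)) (at t)" by (simp add: F(3))
    then show ?thesis using db vector_derivative_unique_at by blast
  qed
  have norm_complex_of: "cmod (complex_of w) = norm w" for w
    by (metis norm_plane_of plane_of_complex_of)
  have cmod_dF: "cmod (deriv F (of_real t)) = c * norm (v (S t)) / h (S t)" for t
    using c h_pos[of "S t"] by (simp add: dF norm_mult norm_divide norm_complex_of)
  have F_inj: "\<exists>n::int. y = x + of_int n" if eq: "F (of_real x) = F (of_real y)" for x y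
  proof -
    have "\<gamma> (S x) = \<gamma> (S y)" using eq unfolding F(3) b_def by (metis plane_of_complex_of)
    then obtain n :: int where n: "S y = S x + of_int n"
      using simple_path_periodic_eq[OF simple per] by blast
    have "T (s + of_int n) = T s + of_int n" for s
      using periodic_int[of "\<lambda>t. T t - t" s n] T(2) by simp
    then have "y = x + of_int n" using n S(2) by metis
    then show ?thesis by blast
  qed
  have dF_nz: "deriv F (of_real t) \<noteq> 0" for t
    using cmod_dF[of t] c h_pos[of "S t"] nz[of "S t"] by (auto simp: v_def)
  obtain \<delta> where \<delta>: "0 < \<delta>" "\<delta> \<le> \<delta>0"
    "\<forall>z\<in>strip \<delta>. \<forall>w\<in>strip \<delta>. F z = F w \<longrightarrow> (\<exists>n::int. w = z + of_int n)"
    using strip_injective_mod_int[OF F(1,2,4) dF_nz F_inj] .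
  have sub: "strip \<delta> \<subseteq> strip \<delta>0" using \<delta>(2) by (auto simp: strip_def)
  show thesis
  proof (rule that)
    show "conformal_strip F \<delta>"
      using \<delta> F(4) sub holomorphic_on_subset[OF F(2) sub] by unfold_locales blast+
    show "c > 0" by (rule c)
    have "range (\<lambda>t. plane_of (F (of_real t))) = range (\<lambda>t. \<gamma> (S t))" by (simp add: F(3) b_def)
    also have "\<dots> = path_image \<gamma>"
    proof (intro equalityI subsetI)
      fix w assume "w \<in> path_image \<gamma>"
      then obtain t where "w = \<gamma> t" by (auto simp: path_image_def)
      then have "w = \<gamma> (S (T t))" using S(1) by simp
      then show "w \<in> range (\<lambda>t. \<gamma> (S t))" by blast
    qed (use on in auto)
    finally show "range (\<lambda>t. plane_of (F (of_real t))) = path_image \<gamma>" .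
    show "2 * p (plane_of (F (of_real t))) = (c / cmod (deriv F (of_real t)))\<^sup>2" for t
    proof -
      have "norm (v (S t)) \<noteq> 0" using nz by (simp add: v_def)
      then have "(c / cmod (deriv F (of_real t)))\<^sup>2 = (h (S t) / norm (v (S t)))\<^sup>2"
        unfolding cmod_dF using c h_pos[of "S t"] by (simp add: field_simps)
      also have "\<dots> = 2 * p (\<gamma> (S t))"
        using arg_pos[of "S t"] \<open>norm (v (S t)) \<noteq> 0\<close> by (simp add: power_divide h_def)
      finally show ?thesis by (simp add: F(3) b_def)
    qed
  qed
qed

lemma current_sheet_exists:
  assumes F: "conformal_strip F \<delta>" and c: "c > 0"
    and \<Omega>: "open \<Omega>" "bounded \<Omega>" "\<Omega> \<noteq> {}"
    and fr: "frontier \<Omega> = range (\<lambda>t. plane_of (F (of_real t)))"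
    and p: "\<And>t. 2 * p (plane_of (F (of_real t))) = (c / cmod (deriv F (of_real t)))\<^sup>2"
  obtains F' where "current_sheet F' \<delta> \<Omega> (\<delta> / 2) c"
    "\<forall>t. 2 * p (plane_of (F' (of_real t))) = (c / cmod (deriv F' (of_real t)))\<^sup>2"
proof -
  interpret conformal_strip F \<delta> by (rule F)
  have layer0: "frontier \<Omega> = layer {0}"
  proof -
    have "{z. Im z \<in> {0}} = range complex_of_real"
      by (auto simp: complex_eq_iff intro!: image_eqI[of _ _ "Re z" for z])
    then show ?thesis unfolding fr layer_def f_def by (simp add: image_image)
  qed
  consider "layer {0<..<\<delta>} \<inter> closure \<Omega> = {}" "layer {-\<delta><..<0} \<subseteq> \<Omega>"
    | "layer {-\<delta><..<0} \<inter> closure \<Omega> = {}" "layer {0<..<\<delta>} \<subseteq> \<Omega>"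
    using one_side_inside[OF \<Omega> layer0] by blast
  then show thesis
  proof cases
    case 1
    then have "current_sheet F \<delta> \<Omega> (\<delta> / 2) c"
      using \<Omega> layer0 \<delta>_pos c by unfold_locales auto
    then show thesis using that p by blast
  next
    case 2
    interpret R: conformal_strip "\<lambda>z. F (- z)" \<delta> by (rule reflected)
    have refl: "R.layer I = layer (uminus ` I)" for I
    proof -
      have "{z. Im z \<in> uminus ` I} = uminus ` {z. Im z \<in> I}"
        by (auto intro!: image_eqI[of _ uminus "- z" for z] simp: image_iff)
      then show ?thesis by (simp add: R.layer_def layer_def R.f_def f_def image_image)
    qed
    have neg: "uminus ` {0<..<\<delta>} = {-\<delta><..<0}" "uminus ` {-\<delta><..<0} = {0<..<\<delta>}" by simp_all
    have "current_sheet (\<lambda>z. F (- z)) \<delta> \<Omega> (\<delta> / 2) c"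
      using 2 \<Omega> layer0 \<delta>_pos c by unfold_locales (simp_all add: refl)
    moreover have "2 * p (plane_of (F (- of_real t))) = (c / cmod (deriv (\<lambda>z. F (- z)) (of_real t)))\<^sup>2" for t
    proof -
      have s: "- complex_of_real t \<in> strip \<delta>" using \<delta>_pos by (simp add: strip_def)
      have "((\<lambda>z. F (- z)) has_field_derivative deriv F (- of_real t) * (- 1)) (at (of_real t))"
        by (rule DERIV_chain2[where g = uminus, OF has_deriv[OF s]]) (auto intro!: derivative_eq_intros)
      then have "deriv (\<lambda>z. F (- z)) (of_real t) = - deriv F (of_real (- t))"
        by (simp add: DERIV_imp_deriv)
      then show ?thesis using p[of "- t"] by simp
    qed
    ultimately show thesis using that[of "\<lambda>z. F (- z)"] by blast
  qed
qed

theorem theorem3: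
  fixes \<Omega> :: "(real^2) set"
    and \<psi> A p :: "real^2 \<Rightarrow> real"
    and u B :: "real^2 \<Rightarrow> real^2"
    and G H :: "real \<Rightarrow> real"
    and k :: nat
  assumes "bounded_sc_analytic_domain \<Omega>"
    and "analytic_MHD_solution \<Omega> u B p"
    and "stream_function \<Omega> \<psi> u"
    and "stream_function \<Omega> A B"
    and "\<forall>x\<in>frontier \<Omega>. A x = 0"
    and "\<exists>!x. x \<in> \<Omega> \<and> B x = 0"
    and "k \<ge> 2"
    and "Ck_on k G UNIV"
    and "Ck_on (k - 1) H UNIV"
    and "\<forall>x\<in>\<Omega>. \<psi> x = G (A x)"
    and "\<forall>x\<in>\<Omega>. p x + (norm (u x))\<^sup>2 / 2 - (norm (B x))\<^sup>2 / 2 = H (A x)"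
    and "\<bar>deriv G 0\<bar> < 1"
    and "\<forall>x\<in>frontier \<Omega>. (norm (B x))\<^sup>2 > - (2 * H 0 / (1 - \<bar>deriv G 0\<bar>\<^sup>2))"
  shows "\<exists>\<gamma> j B_ext.
           smooth_Jordan_param \<gamma> \<and>
           generated_by_current_sheet \<Omega> \<gamma> j B_ext \<and>
           (\<forall>x\<in>frontier \<Omega>.
              (\<forall>n. outward_unit_normal \<Omega> x n \<longrightarrow> B_ext x \<bullet> n = 0) \<and>
              p x = (norm (B_ext x))\<^sup>2 / 2)"
proof -
  from assms(1) obtain \<gamma> where \<Omega>: "open \<Omega>" "bounded \<Omega>" "\<Omega> \<noteq> {}"
    and \<gamma>: "analytic_Jordan_param \<gamma>" "path_image \<gamma> = frontier \<Omega>"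
    unfolding bounded_sc_analytic_domain_def by blast
  have pos: "p x > 0" if x: "x \<in> frontier \<Omega>" for x
  proof -
    have "0 < 1 - \<bar>deriv G 0\<bar>\<^sup>2" using assms(12) by (simp add: abs_square_less_1)
    moreover have "- (2 * H 0 / (1 - \<bar>deriv G 0\<bar>\<^sup>2)) < (norm (B x))\<^sup>2" using assms(13) x by blast
    ultimately have "0 < 2 * H 0 + (1 - \<bar>deriv G 0\<bar>\<^sup>2) * (norm (B x))\<^sup>2"
      by (simp add: field_simps)
    then show ?thesis
      using boundary_pressure[OF \<Omega>(1) assms(2-5,7-11) x] by simp
  qed
  have "real_analytic_on p (path_image \<gamma>)"
    using assms(2) unfolding analytic_MHD_solution_def real_analytic_on_def \<gamma>(2) frontier_def by blast
  from conformal_boundary_parametrization[OF \<gamma>(1), of p, OF this pos[folded \<gamma>(2)]]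
  obtain F \<delta> c where F: "conformal_strip F \<delta>" "c > 0"
    "range (\<lambda>t. plane_of (F (of_real t))) = path_image \<gamma>"
    "\<And>t. 2 * p (plane_of (F (of_real t))) = (c / cmod (deriv F (of_real t)))\<^sup>2"
    by metis
  obtain F' where sheet: "current_sheet F' \<delta> \<Omega> (\<delta> / 2) c"
    and p: "\<forall>t. 2 * p (plane_of (F' (of_real t))) = (c / cmod (deriv F' (of_real t)))\<^sup>2"
    using current_sheet_exists[OF F(1,2) \<Omega> F(3)[unfolded \<gamma>(2), symmetric] F(4)] .
  interpret current_sheet F' \<delta> \<Omega> "\<delta> / 2" c by (rule sheet)
  show ?thesis
  proof (intro exI conjI ballI allI impI)
    show "smooth_Jordan_param \<Gamma>" by (rule smooth_\<Gamma>)
    show "generated_by_current_sheet \<Omega> \<Gamma> sheet_current ext_field" by (rule ext_field_generated)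
    fix x assume "x \<in> frontier \<Omega>"
    then obtain z where z: "Im z = 0" "x = f z" unfolding frontier_\<Omega> layer_def by auto
    then have x: "x = f (of_real (Re z))" by (metis complex_is_Real_iff of_real_Re)
    show "ext_field x \<bullet> n = 0" if "outward_unit_normal \<Omega> x n" for n
      using that unfolding x by (rule ext_field_tangential)
    show "p x = (norm (ext_field x))\<^sup>2 / 2"
      using p[rule_format, of "Re z"] c_pos unfolding x ext_field_frontier by (simp add: f_def norm_divide)
  qed
qed

end
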